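(* Let $E$ be a compact subset of $\widehat{\mathbb Z}=\prod_{p\in\mathbb P}\mathbb Z_p$, and for each prime $p$ let $E_p=\pi_p(E)\subseteq\mathbb Z_p$ be the image of $E$ under the projection $\pi_p$ from $\widehat{\mathbb Z}$ onto $\mathbb Z_p$. The topological closure, with respect to the uniform convergence topology, of the ring of polynomial functions $\mathrm{Int}_{\mathbb Q}(E,\widehat{\mathbb Z})$ in the ring $\mathcal C(E,\widehat{\mathbb Z})$ of continuous functions from $E$ into $\widehat{\mathbb Z}$ is the subring formed by the restrictions to $E$ of the functions belonging to the product $\prod_{p\in\mathbb P}\mathcal C(E_p,\mathbb Z_p)$.
   Context: $\mathbb P$ is the set of prime numbers. $\widehat{\mathbb Z}$ is identified with $\prod_{p\in\mathbb P}\mathbb Z_p$ with the product topology. A polynomial $f\in\mathbb Q[x]$ is evaluated at $\underline\alpha=(\alpha_p)_p\in\widehat{\mathbb Z}$ componentwise: $f(\underline\alpha)=(f(\alpha_p))_p\in\prod_p\mathbb Q_p$. $\mathrm{Int}_{\mathbb Q}(E,\widehat{\mathbb Z})=\{f\in\mathbb Q[x]\mid f(E)\subseteq\widehat{\mathbb Z}\}$, whose elements are regarded as functions $E\to\widehat{\mathbb Z}$. $\mathcal C(X,Y)$ denotes the ring of continuous functions from $X$ to $Y$. Put $\underline E=\prod_{p}E_p\supseteq E$. The product $\prod_{p}\mathcal C(E_p,\mathbb Z_p)$ is viewed inside $\mathcal C(\underline E,\widehat{\mathbb Z})$ by letting $(\varphi_p)_p$ act as $(\alpha_p)_p\mapsto(\varphi_p(\alpha_p))_p$.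 *)

theory Defs
  imports
    "HOL-Analysis.Analysis"
    "HOL-Algebra.Subrings"
    "HOL-Computational_Algebra.Computational_Algebra"
begin

section \<open>The field of p-adic numbers\<close>

definition padic_val :: "nat \<Rightarrow> rat \<Rightarrow> int" where
  "padic_val p q =
     int (multiplicity (int p) (fst (quotient_of q))) -
     int (multiplicity (int p) (snd (quotient_of q)))"

definition padic_abs :: "nat \<Rightarrow> rat \<Rightarrow> real" where
  "padic_abs p q = (if q = 0 then 0 else real p powi (- padic_val p q))"

definition padic_Cauchy :: "nat \<Rightarrow> (nat \<Rightarrow> rat) set" where
  "padic_Cauchy p =
     {X. \<forall>e>0. \<exists>N. \<forall>m\<ge>N. \<forall>n\<ge>N. padic_abs p (X m - X n) < e}"

definition padic_null :: "nat \<Rightarrow> (nat \<Rightarrow> rat) set" where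
  "padic_null p = {X. (\<lambda>n. padic_abs p (X n)) \<longlonglongrightarrow> 0}"

definition padic_Cauchy_ring :: "nat \<Rightarrow> (nat \<Rightarrow> rat) ring" where
  "padic_Cauchy_ring p =
     \<lparr>carrier = padic_Cauchy p,
      mult = (\<lambda>X Y n. X n * Y n), one = (\<lambda>n. 1),
      zero = (\<lambda>n. 0), add = (\<lambda>X Y n. X n + Y n)\<rparr>"

text \<open>$\mathbb{Q}_p$ is the completion of $\mathbb{Q}$ for the p-adic absolute value:
  Cauchy sequences modulo null sequences.\<close>

type_synonym padic = "(nat \<Rightarrow> rat) set"

definition Qp :: "nat \<Rightarrow> padic ring" where
  "Qp p = padic_Cauchy_ring p Quot padic_null p"

definition Qp_of_rat :: "nat \<Rightarrow> rat \<Rightarrow> padic" where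
  "Qp_of_rat p q = padic_null p +>\<^bsub>padic_Cauchy_ring p\<^esub> (\<lambda>n. q)"

definition Qp_abs :: "nat \<Rightarrow> padic \<Rightarrow> real" where
  "Qp_abs p x = (THE r. \<forall>X\<in>x. (\<lambda>n. padic_abs p (X n)) \<longlonglongrightarrow> r)"

text \<open>The locale for metric spaces requires nonnegativity and symmetry on the whole type,
  hence the default value outside the carrier.\<close>

definition Qp_dist :: "nat \<Rightarrow> padic \<Rightarrow> padic \<Rightarrow> real" where
  "Qp_dist p x y =
     (if x \<in> carrier (Qp p) \<and> y \<in> carrier (Qp p) then Qp_abs p (x \<ominus>\<^bsub>Qp p\<^esub> y) else 0)"

definition Qp_eval :: "nat \<Rightarrow> rat poly \<Rightarrow> padic \<Rightarrow> padic" where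
  "Qp_eval p f x =
     (\<Oplus>\<^bsub>Qp p\<^esub>i\<in>{..degree f}. Qp_of_rat p (poly.coeff f i) \<otimes>\<^bsub>Qp p\<^esub> (x [^]\<^bsub>Qp p\<^esub> i))"

definition Zp_ring :: "nat \<Rightarrow> padic ring" where
  "Zp_ring p = (Qp p)\<lparr>carrier := {x \<in> carrier (Qp p). Qp_abs p x \<le> 1}\<rparr>"

definition Zp_top :: "nat \<Rightarrow> padic topology" where
  "Zp_top p = Metric_space.mtopology (carrier (Zp_ring p)) (Qp_dist p)"


section \<open>The profinite integers\<close>

definition prod_ring :: "'i set \<Rightarrow> ('i \<Rightarrow> 'a ring) \<Rightarrow> ('i \<Rightarrow> 'a) ring" where
  "prod_ring I R =
     \<lparr>carrier = (\<Pi>\<^sub>E i\<in>I. carrier (R i)),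
      mult = (\<lambda>x y. \<lambda>i\<in>I. x i \<otimes>\<^bsub>R i\<^esub> y i), one = (\<lambda>i\<in>I. \<one>\<^bsub>R i\<^esub>),
      zero = (\<lambda>i\<in>I. \<zero>\<^bsub>R i\<^esub>), add = (\<lambda>x y. \<lambda>i\<in>I. x i \<oplus>\<^bsub>R i\<^esub> y i)\<rparr>"

abbreviation primes :: "nat set" where
  "primes \<equiv> {p. prime p}"

definition Zhat_ring :: "(nat \<Rightarrow> padic) ring" where
  "Zhat_ring = prod_ring primes Zp_ring"

definition Zhat_top :: "(nat \<Rightarrow> padic) topology" where
  "Zhat_top = product_topology Zp_top primes"

definition Zhat_proj :: "nat \<Rightarrow> (nat \<Rightarrow> padic) set \<Rightarrow> padic set" where
  "Zhat_proj p E = (\<lambda>\<alpha>. \<alpha> p) ` E"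

text \<open>Componentwise evaluation, with values in $\prod_p \mathbb{Q}_p$.\<close>

definition adelic_eval :: "rat poly \<Rightarrow> (nat \<Rightarrow> padic) \<Rightarrow> (nat \<Rightarrow> padic)" where
  "adelic_eval f \<alpha> = (\<lambda>p\<in>primes. Qp_eval p f (\<alpha> p))"

definition IntQ :: "(nat \<Rightarrow> padic) set \<Rightarrow> rat poly set" where
  "IntQ E = {f. adelic_eval f ` E \<subseteq> carrier Zhat_ring}"

definition IntQ_functions ::
    "(nat \<Rightarrow> padic) set \<Rightarrow> ((nat \<Rightarrow> padic) \<Rightarrow> (nat \<Rightarrow> padic)) set" where
  "IntQ_functions E = (\<lambda>f. restrict (adelic_eval f) E) ` IntQ E"


section \<open>Continuous functions and uniform convergence\<close>

definition cont_funs :: "'a topology \<Rightarrow> 'b topology \<Rightarrow> ('a \<Rightarrow> 'b) set" where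
  "cont_funs X Y = {\<phi> \<in> extensional (topspace X). continuous_map X Y \<phi>}"

definition C_Zhat ::
    "(nat \<Rightarrow> padic) set \<Rightarrow> ((nat \<Rightarrow> padic) \<Rightarrow> (nat \<Rightarrow> padic)) ring" where
  "C_Zhat E = (prod_ring E (\<lambda>_. Zhat_ring))
     \<lparr>carrier := cont_funs (subtopology Zhat_top E) Zhat_top\<rparr>"

text \<open>Basic entourages of the product uniformity on $\prod_p \mathbb{Z}_p$ bound finitely many
  components; a basic neighbourhood of \<open>\<phi>\<close> for uniform convergence consists of all \<open>\<psi>\<close> that are
  uniformly close to \<open>\<phi>\<close> with respect to such an entourage.\<close>

definition unif_nbhd ::
    "(nat \<Rightarrow> padic) set \<Rightarrow> nat set \<Rightarrow> real \<Rightarrow> ((nat \<Rightarrow> padic) \<Rightarrow> (nat \<Rightarrow> padic)) \<Rightarrow>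
     ((nat \<Rightarrow> padic) \<Rightarrow> (nat \<Rightarrow> padic)) set" where
  "unif_nbhd E P e \<phi> =
     {\<psi> \<in> carrier (C_Zhat E). \<forall>\<alpha>\<in>E. \<forall>p\<in>P. Qp_dist p (\<phi> \<alpha> p) (\<psi> \<alpha> p) < e}"

definition unif_open ::
    "(nat \<Rightarrow> padic) set \<Rightarrow> ((nat \<Rightarrow> padic) \<Rightarrow> (nat \<Rightarrow> padic)) set \<Rightarrow> bool" where
  "unif_open E U \<longleftrightarrow> U \<subseteq> carrier (C_Zhat E) \<and>
     (\<forall>\<phi>\<in>U. \<exists>P e. finite P \<and> P \<subseteq> primes \<and> e > 0 \<and> unif_nbhd E P e \<phi> \<subseteq> U)"

definition unif_top ::
    "(nat \<Rightarrow> padic) set \<Rightarrow> ((nat \<Rightarrow> padic) \<Rightarrow> (nat \<Rightarrow> padic)) topology" where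
  "unif_top E = topology (unif_open E)"

lemma istopology_unif_open: "istopology (unif_open E)"
proof -
  have "unif_open E (S \<inter> T)" if S: "unif_open E S" and T: "unif_open E T" for S T
    unfolding unif_open_def
  proof (intro conjI ballI)
    show "S \<inter> T \<subseteq> carrier (C_Zhat E)" using S by (auto simp: unif_open_def)
    fix \<phi> assume "\<phi> \<in> S \<inter> T"
    then obtain P e Q d where
      "finite P" "P \<subseteq> primes" "e > 0" and 1: "unif_nbhd E P e \<phi> \<subseteq> S" and
      "finite Q" "Q \<subseteq> primes" "d > 0" and 2: "unif_nbhd E Q d \<phi> \<subseteq> T"
      using S T unfolding unif_open_def by (meson IntD1 IntD2)
    moreover have "unif_nbhd E (P \<union> Q) (min e d) \<phi> \<subseteq> unif_nbhd E P e \<phi> \<inter> unif_nbhd E Q d \<phi>"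
      by (auto simp: unif_nbhd_def)
    ultimately show "\<exists>P e. finite P \<and> P \<subseteq> primes \<and> e > 0 \<and> unif_nbhd E P e \<phi> \<subseteq> S \<inter> T"
      by (intro exI[of _ "P \<union> Q"] exI[of _ "min e d"]) auto
  qed
  moreover have "unif_open E (\<Union>\<K>)" if "\<And>K. K \<in> \<K> \<Longrightarrow> unif_open E K" for \<K>
    using that unfolding unif_open_def by (meson Sup_least UnionE Union_upper order_trans)
  ultimately show ?thesis unfolding istopology_def by blast
qed


section \<open>Products of continuous functions\<close>

definition prod_C :: "(nat \<Rightarrow> padic) set \<Rightarrow> (nat \<Rightarrow> padic \<Rightarrow> padic) set" where
  "prod_C E =
     (\<Pi>\<^sub>E p\<in>primes. cont_funs (subtopology (Zp_top p) (Zhat_proj p E)) (Zp_top p))"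

text \<open>The function on $\prod_p E_p$ given by an element of the product.\<close>

definition prod_fun ::
    "(nat \<Rightarrow> padic) set \<Rightarrow> (nat \<Rightarrow> padic \<Rightarrow> padic) \<Rightarrow> (nat \<Rightarrow> padic) \<Rightarrow> (nat \<Rightarrow> padic)" where
  "prod_fun E \<Phi> = (\<lambda>\<alpha>\<in>(\<Pi>\<^sub>E p\<in>primes. Zhat_proj p E). \<lambda>p\<in>primes. \<Phi> p (\<alpha> p))"

definition prod_C_restrictions ::
    "(nat \<Rightarrow> padic) set \<Rightarrow> ((nat \<Rightarrow> padic) \<Rightarrow> (nat \<Rightarrow> padic)) set" where
  "prod_C_restrictions E = (\<lambda>\<Phi>. restrict (prod_fun E \<Phi>) E) ` prod_C E"

end

theory Submission
  imports Defs "HOL-Number_Theory.Residues"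
begin

text \<open>A polynomial acts on each component separately, so a limit \<open>\<phi>\<close> of polynomial functions has a
  \<open>p\<close>-component depending on \<open>\<alpha>\<^sub>p\<close> only; since \<open>E \<rightarrow> E\<^sub>p\<close> is a quotient map, this component is
  induced by a continuous function on \<open>E\<^sub>p\<close>. Conversely, a basic neighbourhood constrains finitely
  many primes \<open>p\<close>. By uniform continuity on the compact \<open>E\<^sub>p\<close>, the function to be approximated may be
  replaced by one depending only on the residue modulo some \<open>p^n\<close>, with values in the natural numbers.
  Modulo \<open>p^K\<close> such a function is an integer-valued polynomial, built from powers of binomial
  coefficients; the Chinese remainder theorem glues these over the finitely many primes, and
  integer-valuedness takes care of all the other primes.\<close>

section \<open>The p-adic absolute value\<close>

text \<open>Elements of \<open>Qp p\<close> are classes of rational Cauchy sequences, so identities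
  and estimates are proved for rationals and passed to the limit. Every p-adic integer is
  represented by a sequence of natural numbers; hence a polynomial with integer values on the
  naturals maps Z_p into itself for all primes p simultaneously, and approximating at finitely many
  primes costs nothing at the others. The obstacle is to imitate a locally constant function by such
  a polynomial. Integer coefficients are too rigid: they give f(m + p) = f(m) modulo p, so they
  cannot separate residue classes modulo p^n for n > 1. Binomial coefficients can: (y + 1) C(y, p^n
  - 1) = p^n C(y + 1, p^n) forces p to divide C(y, p^n - 1) unless p^n divides y + 1. Throughout,
  the strong triangle inequality keeps errors from adding up, so one bound e survives a chain of
  approximations.\<close>

lemma padic_val_divide:
  assumes "prime p" "a \<noteq> 0" "b \<noteq> 0"
  shows "padic_val p (of_int a / of_int b) =
    int (multiplicity (int p) a) - int (multiplicity (int p) b)"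
proof -
  obtain c d where cd: "quotient_of (of_int a / of_int b) = (c, d)"
    by fastforce
  have d: "d > 0" and q: "of_int a / of_int b = (of_int c / of_int d :: rat)"
    using quotient_of_denom_pos[OF cd] quotient_of_div[OF cd] by auto
  \<comment> \<open>The definition uses the reduced fraction c/d; cross-multiplication compares its
    multiplicities with those of the arbitrary fraction a/b.\<close>
  have "of_int (a * d) = (of_int (c * b) :: rat)"
    using q d assms by (simp add: field_simps)
  then have eq: "a * d = c * b" by linarith
  then have c: "c \<noteq> 0" using assms d by auto
  have "prime_elem (int p)" using assms by simp
  then have "multiplicity (int p) a + multiplicity (int p) d =
      multiplicity (int p) c + multiplicity (int p) b"
    using eq c d assms by (metis less_irrefl prime_elem_multiplicity_mult_distrib)
  then show ?thesis using cd by (simp add: padic_val_def)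
qed

lemma rat_divide_cases:
  obtains a b :: int where "x = (of_int a / of_int b :: rat)" "b > 0"
  by (metis quotient_of_denom_pos quotient_of_div surj_pair)

lemma padic_abs_0 [simp]: "padic_abs p 0 = 0"
  by (simp add: padic_abs_def)

lemma padic_abs_nonneg [simp]: "padic_abs p x \<ge> 0"
  by (simp add: padic_abs_def)

lemma padic_abs_divide:
  assumes "prime p" "a \<noteq> 0" "b \<noteq> 0"
  shows "padic_abs p (of_int a / of_int b) =
    real p powi (int (multiplicity (int p) b) - int (multiplicity (int p) a))"
  using assms by (simp add: padic_abs_def padic_val_divide)

lemma padic_abs_1 [simp]: "prime p \<Longrightarrow> padic_abs p 1 = 1"
  using padic_abs_divide[of p 1 1] by simp

lemma padic_abs_mult:
  assumes p: "prime p"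
  shows "padic_abs p (x * y) = padic_abs p x * padic_abs p y"
proof (cases "x = 0 \<or> y = 0")
  case False
  obtain a b where x: "x = of_int a / of_int b" "b > 0" by (rule rat_divide_cases)
  obtain c d where y: "y = of_int c / of_int d" "d > 0" by (rule rat_divide_cases)
  have nz: "a \<noteq> 0" "c \<noteq> 0" "b \<noteq> 0" "d \<noteq> 0" using False x y by auto
  have "x * y = of_int (a * c) / of_int (b * d)" using x y by simp
  then have "padic_abs p (x * y) = real p powi
     (int (multiplicity (int p) (b * d)) - int (multiplicity (int p) (a * c)))"
    using padic_abs_divide[OF p, of "a * c" "b * d"] nz by simp
  also have "\<dots> = real p powi ((int (multiplicity (int p) b) - int (multiplicity (int p) a)) +
      (int (multiplicity (int p) d) - int (multiplicity (int p) c)))"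
    using p nz by (simp add: prime_elem_multiplicity_mult_distrib algebra_simps)
  also have "\<dots> = padic_abs p x * padic_abs p y"
    using p nz x y by (subst power_int_add) (auto simp: padic_abs_divide prime_gt_0_nat)
  finally show ?thesis .
qed auto

lemma padic_abs_eq_0 [simp]: "prime p \<Longrightarrow> padic_abs p x = 0 \<longleftrightarrow> x = 0"
  by (auto simp: padic_abs_def prime_gt_0_nat power_int_eq_0_iff)

text \<open>The bridge from number theory to metric estimates: the congruences obtained later become
  bounds on distances through it.\<close>

lemma padic_abs_of_int_le_iff:
  assumes p: "prime p"
  shows "padic_abs p (of_int u) \<le> inverse (real p ^ k) \<longleftrightarrow> int p ^ k dvd u"
proof (cases "u = 0")
  case False
  have p1: "real p > 1" using prime_gt_1_nat[OF p] by simp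
  have nu: "\<not> is_unit (int p)" using p by auto
  have "padic_abs p (of_int u) = inverse (real p ^ multiplicity (int p) u)"
    using padic_abs_divide[OF p False, of 1] by (simp add: power_int_minus)
  also have "\<dots> \<le> inverse (real p ^ k) \<longleftrightarrow> real p ^ k \<le> real p ^ multiplicity (int p) u"
    using p1 by (intro inverse_le_iff_le) auto
  also have "\<dots> \<longleftrightarrow> k \<le> multiplicity (int p) u"
    using p1 by (intro power_increasing_iff) auto
  also have "\<dots> \<longleftrightarrow> int p ^ k dvd u"
    by (rule power_dvd_iff_le_multiplicity[OF False nu, symmetric])
  finally show ?thesis .
qed auto

lemma padic_abs_of_int_le_1: "prime p \<Longrightarrow> padic_abs p (of_int u) \<le> 1"
  using padic_abs_of_int_le_iff[of p u 0] by simp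

lemma padic_abs_of_nat_le_1: "prime p \<Longrightarrow> padic_abs p (of_nat u) \<le> 1"
  using padic_abs_of_int_le_1[of p "int u"] by simp

lemma padic_abs_minus [simp]: "prime p \<Longrightarrow> padic_abs p (- x) = padic_abs p x"
proof -
  assume p: "prime p"
  have "padic_abs p (-1) = 1"
    using padic_abs_divide[OF p, of "-1" 1] by simp
  then show ?thesis using padic_abs_mult[OF p, of "-1" x] by simp
qed

lemma padic_abs_minus_commute: "prime p \<Longrightarrow> padic_abs p (x - y) = padic_abs p (y - x)"
  using padic_abs_minus[of p "x - y"] by simp

text \<open>For integers, a prime power dividing both summands divides the sum; multiplying by a
  common denominator carries this over to rationals.\<close>

lemma padic_abs_add:
  assumes p: "prime p"
  shows "padic_abs p (x + y) \<le> max (padic_abs p x) (padic_abs p y)"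
proof -
  have int_le: "padic_abs p (of_int (u + v)) \<le> padic_abs p (of_int u)"
    if le: "padic_abs p (of_int v) \<le> padic_abs p (of_int u)" for u v
  proof (cases "u = 0")
    case False
    \<comment> \<open>The larger absolute value is exactly p^-m, so the other summand, being no
      larger, is also divisible by p^m.\<close>
    define m where "m = multiplicity (int p) u"
    have m: "padic_abs p (of_int u) = inverse (real p ^ m)"
      using padic_abs_divide[OF p False, of 1] by (simp add: power_int_minus m_def)
    then have "int p ^ m dvd u" "int p ^ m dvd v"
      using le by (simp_all flip: padic_abs_of_int_le_iff[OF p])
    then show ?thesis
      unfolding m padic_abs_of_int_le_iff[OF p] by simp
  qed (use that p in auto)
  obtain a b where x: "x = of_int a / of_int b" "b > 0" by (rule rat_divide_cases)
  obtain c d where y: "y = of_int c / of_int d" "d > 0" by (rule rat_divide_cases)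
  define u v w where "u = a * d" and "v = c * b" and "w = b * d"
  have xw: "of_int u = x * of_int w" and yw: "of_int v = y * of_int w" and w: "w \<noteq> 0"
    using x y by (auto simp: u_def v_def w_def)
  have "padic_abs p (of_int (u + v)) \<le> max (padic_abs p (of_int u)) (padic_abs p (of_int v))"
    using int_le[of u v] int_le[of v u] by (auto simp: max_def add.commute)
  moreover have "of_int (u + v) = (x + y) * of_int w" using xw yw by (simp add: algebra_simps)
  ultimately have "padic_abs p (x + y) * padic_abs p (of_int w) \<le>
      max (padic_abs p x) (padic_abs p y) * padic_abs p (of_int w)"
    using xw yw by (simp add: padic_abs_mult[OF p] max_mult_distrib_right)
  moreover have "padic_abs p (of_int w) > 0"
    using w p by (simp add: less_le)
  ultimately show ?thesis by simp
qed

lemma padic_abs_diff: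
  "prime p \<Longrightarrow> padic_abs p (x - y) \<le> max (padic_abs p x) (padic_abs p y)"
  using padic_abs_add[of p x "- y"] by simp

lemma padic_abs_triangle: "prime p \<Longrightarrow> padic_abs p (x + y) \<le> padic_abs p x + padic_abs p y"
  using padic_abs_add[of p x y] padic_abs_nonneg[of p x] padic_abs_nonneg[of p y] by linarith

lemma abs_padic_abs_diff:
  assumes "prime p"
  shows "\<bar>padic_abs p x - padic_abs p y\<bar> \<le> padic_abs p (x - y)"
  using padic_abs_triangle[OF assms, of "x - y" y] padic_abs_triangle[OF assms, of "y - x" x]
    padic_abs_minus_commute[OF assms, of x y] by simp

section \<open>Cauchy sequences and null sequences of rationals\<close>

lemma padic_CauchyD:
  "X \<in> padic_Cauchy p \<Longrightarrow> e > 0 \<Longrightarrow> \<exists>N. \<forall>m\<ge>N. \<forall>n\<ge>N. padic_abs p (X m - X n) < e"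
  by (auto simp: padic_Cauchy_def)

text \<open>By the reverse triangle inequality the absolute values form a real Cauchy sequence.
  Their limit later becomes \<open>Qp_abs\<close>, and convergence also bounds the sequence.\<close>

lemma convergent_padic_abs:
  assumes "prime p" "X \<in> padic_Cauchy p"
  shows "convergent (\<lambda>n. padic_abs p (X n))"
proof (rule Cauchy_convergent, rule CauchyI)
  fix e :: real assume "e > 0"
  with assms obtain N where "\<forall>m\<ge>N. \<forall>n\<ge>N. padic_abs p (X m - X n) < e"
    using padic_CauchyD by blast
  then show "\<exists>M. \<forall>m\<ge>M. \<forall>n\<ge>M. norm (padic_abs p (X m) - padic_abs p (X n)) < e"
    using abs_padic_abs_diff[OF assms(1)] by (metis le_less_trans real_norm_def)
qed

lemma padic_Cauchy_bounded:
  assumes "prime p" "X \<in> padic_Cauchy p"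
  obtains B where "B > 0" "\<And>n. padic_abs p (X n) \<le> B"
proof -
  obtain K where "K > 0" "\<forall>n. norm (padic_abs p (X n)) \<le> K"
    using convergent_imp_Bseq[OF convergent_padic_abs[OF assms]] by (rule BseqE)
  then show ?thesis using that[of K] by simp
qed

lemma padic_Cauchy_add:
  assumes p: "prime p" and X: "X \<in> padic_Cauchy p" and Y: "Y \<in> padic_Cauchy p"
  shows "(\<lambda>n. X n + Y n) \<in> padic_Cauchy p"
  unfolding padic_Cauchy_def
proof (intro CollectI allI impI)
  fix e :: real assume e: "e > 0"
  obtain M where M: "\<forall>m\<ge>M. \<forall>n\<ge>M. padic_abs p (X m - X n) < e"
    using padic_CauchyD[OF X e] by blast
  obtain N where N: "\<forall>m\<ge>N. \<forall>n\<ge>N. padic_abs p (Y m - Y n) < e"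
    using padic_CauchyD[OF Y e] by blast
  have "padic_abs p (X m + Y m - (X n + Y n)) < e" if "m \<ge> max M N" "n \<ge> max M N" for m n
  proof -
    have "padic_abs p (X m + Y m - (X n + Y n)) \<le>
        max (padic_abs p (X m - X n)) (padic_abs p (Y m - Y n))"
      using padic_abs_add[OF p, of "X m - X n" "Y m - Y n"] by (simp add: algebra_simps)
    then show ?thesis using M N that by (meson le_less_trans max.boundedE max_less_iff_conj)
  qed
  then show "\<exists>N. \<forall>m\<ge>N. \<forall>n\<ge>N. padic_abs p (X m + Y m - (X n + Y n)) < e" by blast
qed

lemma padic_Cauchy_const [simp]: "(\<lambda>n. c) \<in> padic_Cauchy p"
  by (simp add: padic_Cauchy_def)

lemma padic_Cauchy_mult:
  assumes p: "prime p" and X: "X \<in> padic_Cauchy p" and Y: "Y \<in> padic_Cauchy p"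
  shows "(\<lambda>n. X n * Y n) \<in> padic_Cauchy p"
  unfolding padic_Cauchy_def
proof (intro CollectI allI impI)
  fix e :: real assume e: "e > 0"
  obtain B where B: "B > 0" "\<And>n. padic_abs p (X n) \<le> B" using padic_Cauchy_bounded[OF p X] by blast
  obtain C where C: "C > 0" "\<And>n. padic_abs p (Y n) \<le> C" using padic_Cauchy_bounded[OF p Y] by blast
  obtain M where M: "\<forall>m\<ge>M. \<forall>n\<ge>M. padic_abs p (X m - X n) < e / C"
    using padic_CauchyD[OF X] e C by (meson divide_pos_pos)
  obtain N where N: "\<forall>m\<ge>N. \<forall>n\<ge>N. padic_abs p (Y m - Y n) < e / B"
    using padic_CauchyD[OF Y] e B by (meson divide_pos_pos)
  have "padic_abs p (X m * Y m - X n * Y n) < e" if mn: "m \<ge> max M N" "n \<ge> max M N" for m n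
  proof -
    \<comment> \<open>The splitting X m (Y m - Y n) + (X m - X n) Y n explains the radii e/B and
      e/C. A maximum of two terms is taken instead of a sum, so \<open>e\<close> is not
      halved.\<close>
    have "padic_abs p (X m * Y m - X n * Y n) \<le>
        max (padic_abs p (X m) * padic_abs p (Y m - Y n)) (padic_abs p (X m - X n) * padic_abs p (Y n))"
      using padic_abs_add[OF p, of "X m * (Y m - Y n)" "(X m - X n) * Y n"]
      by (simp add: algebra_simps padic_abs_mult[OF p, symmetric])
    moreover have "padic_abs p (X m) * padic_abs p (Y m - Y n) \<le> B * padic_abs p (Y m - Y n)"
      using B by (intro mult_right_mono) auto
    moreover have "B * padic_abs p (Y m - Y n) < e"
      using N mn B by (simp add: field_simps)
    moreover have "padic_abs p (X m - X n) * padic_abs p (Y n) \<le> padic_abs p (X m - X n) * C"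
      using C by (intro mult_left_mono) auto
    moreover have "padic_abs p (X m - X n) * C < e"
      using M mn C by (simp add: field_simps)
    ultimately show ?thesis by linarith
  qed
  then show "\<exists>N. \<forall>m\<ge>N. \<forall>n\<ge>N. padic_abs p (X m * Y m - X n * Y n) < e" by blast
qed

lemma padic_Cauchy_uminus:
  "prime p \<Longrightarrow> X \<in> padic_Cauchy p \<Longrightarrow> (\<lambda>n. - X n) \<in> padic_Cauchy p"
  using padic_Cauchy_mult[of p "\<lambda>_. -1" X] by simp

lemma padic_Cauchy_diff:
  "prime p \<Longrightarrow> X \<in> padic_Cauchy p \<Longrightarrow> Y \<in> padic_Cauchy p \<Longrightarrow> (\<lambda>n. X n - Y n) \<in> padic_Cauchy p"
  using padic_Cauchy_add[of p X "\<lambda>n. - Y n"] padic_Cauchy_uminus[of p Y] by simp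

lemma padic_null_subset_Cauchy:
  assumes p: "prime p" shows "padic_null p \<subseteq> padic_Cauchy p"
proof
  fix X assume "X \<in> padic_null p"
  then have lim: "(\<lambda>n. padic_abs p (X n)) \<longlonglongrightarrow> 0" by (simp add: padic_null_def)
  show "X \<in> padic_Cauchy p"
    unfolding padic_Cauchy_def
  proof (intro CollectI allI impI)
    fix e :: real assume "e > 0"
    then obtain N where "\<forall>n\<ge>N. padic_abs p (X n) < e"
      using LIMSEQ_D[OF lim] by fastforce
    then show "\<exists>N. \<forall>m\<ge>N. \<forall>n\<ge>N. padic_abs p (X m - X n) < e"
      using padic_abs_diff[OF p] by (meson le_less_trans max_less_iff_conj)
  qed
qed

lemma padic_null_add:
  assumes "prime p" "X \<in> padic_null p" "Y \<in> padic_null p"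
  shows "(\<lambda>n. X n + Y n) \<in> padic_null p"
proof -
  have lim: "(\<lambda>n. padic_abs p (X n) + padic_abs p (Y n)) \<longlonglongrightarrow> 0 + 0"
    using assms by (intro tendsto_add) (auto simp: padic_null_def)
  have "(\<lambda>n. padic_abs p (X n + Y n)) \<longlonglongrightarrow> 0"
    by (rule tendsto_sandwich[OF _ _ tendsto_const lim[simplified]])
      (use assms(1) in \<open>auto simp: padic_abs_triangle\<close>)
  then show ?thesis by (simp add: padic_null_def)
qed

lemma padic_null_mult:
  assumes "prime p" "X \<in> padic_Cauchy p" "Y \<in> padic_null p"
  shows "(\<lambda>n. X n * Y n) \<in> padic_null p"
proof -
  have "Bseq (\<lambda>n. padic_abs p (X n))"
    using convergent_imp_Bseq[OF convergent_padic_abs] assms by blast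
  moreover have "Zfun (\<lambda>n. padic_abs p (Y n)) sequentially"
    using assms by (simp add: padic_null_def tendsto_Zfun_iff)
  ultimately have "Zfun (\<lambda>n. padic_abs p (X n) * padic_abs p (Y n)) sequentially"
    by (intro bounded_bilinear.Bfun_prod_Zfun[OF bounded_bilinear_mult])
  then show ?thesis using assms by (simp add: padic_null_def tendsto_Zfun_iff padic_abs_mult)
qed

lemma cring_padic_Cauchy_ring:
  assumes p: "prime p" shows "cring (padic_Cauchy_ring p)"
proof (rule cringI)
  show "abelian_group (padic_Cauchy_ring p)"
  proof (rule abelian_groupI)
    fix X assume "X \<in> carrier (padic_Cauchy_ring p)"
    then show "\<exists>Y\<in>carrier (padic_Cauchy_ring p). Y \<oplus>\<^bsub>padic_Cauchy_ring p\<^esub> X = \<zero>\<^bsub>padic_Cauchy_ring p\<^esub>"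
      using padic_Cauchy_uminus[OF p, of X]
      by (intro bexI[of _ "\<lambda>n. - X n"]) (auto simp: padic_Cauchy_ring_def)
  qed (use p in \<open>auto simp: padic_Cauchy_ring_def padic_Cauchy_add algebra_simps\<close>)
  show "comm_monoid (padic_Cauchy_ring p)"
    by (rule comm_monoidI) (use p in \<open>auto simp: padic_Cauchy_ring_def padic_Cauchy_mult algebra_simps\<close>)
qed (auto simp: padic_Cauchy_ring_def algebra_simps)

lemma padic_Cauchy_ring_a_inv:
  assumes p: "prime p" and X: "X \<in> padic_Cauchy p"
  shows "\<ominus>\<^bsub>padic_Cauchy_ring p\<^esub> X = (\<lambda>n. - X n)"
proof -
  interpret cring "padic_Cauchy_ring p" by (rule cring_padic_Cauchy_ring[OF p])
  show ?thesis
    by (rule minus_equality) (use assms padic_Cauchy_uminus in \<open>auto simp: padic_Cauchy_ring_def\<close>)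
qed

lemma ideal_padic_null:
  assumes p: "prime p" shows "ideal (padic_null p) (padic_Cauchy_ring p)"
proof (rule idealI)
  interpret cring "padic_Cauchy_ring p" by (rule cring_padic_Cauchy_ring[OF p])
  show "ring (padic_Cauchy_ring p)" ..
  show "subgroup (padic_null p) (add_monoid (padic_Cauchy_ring p))"
  proof (rule add.subgroupI)
    fix X assume X: "X \<in> padic_null p"
    then have "X \<in> padic_Cauchy p" using padic_null_subset_Cauchy[OF p] by blast
    then show "\<ominus>\<^bsub>padic_Cauchy_ring p\<^esub> X \<in> padic_null p"
      using padic_Cauchy_ring_a_inv[OF p] X p by (simp add: padic_null_def)
  next
    have "(\<lambda>n. 0) \<in> padic_null p" by (simp add: padic_null_def)
    then show "padic_null p \<noteq> {}" by blast
  next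
    show "padic_null p \<subseteq> carrier (padic_Cauchy_ring p)"
      using padic_null_subset_Cauchy[OF p] by (simp add: padic_Cauchy_ring_def)
  next
    fix X Y assume "X \<in> padic_null p" "Y \<in> padic_null p"
    then show "X \<oplus>\<^bsub>padic_Cauchy_ring p\<^esub> Y \<in> padic_null p"
      using padic_null_add[OF p] by (simp add: padic_Cauchy_ring_def)
  qed
next
  fix X Y assume "X \<in> padic_null p" "Y \<in> carrier (padic_Cauchy_ring p)"
  then show "Y \<otimes>\<^bsub>padic_Cauchy_ring p\<^esub> X \<in> padic_null p" "X \<otimes>\<^bsub>padic_Cauchy_ring p\<^esub> Y \<in> padic_null p"
    using padic_null_mult[OF p, of Y X] by (auto simp: padic_Cauchy_ring_def mult.commute)
qed

section \<open>The p-adic numbers\<close>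

text \<open>The quotient map onto \<open>Qp p\<close> under a name of its own, so that field
  computations can be carried out termwise on representatives.\<close>

definition padic_class :: "nat \<Rightarrow> (nat \<Rightarrow> rat) \<Rightarrow> padic" where
  "padic_class p X = padic_null p +>\<^bsub>padic_Cauchy_ring p\<^esub> X"

lemma Qp_of_rat_eq: "Qp_of_rat p q = padic_class p (\<lambda>n. q)"
  by (simp add: Qp_of_rat_def padic_class_def)

lemma cring_Qp: "prime p \<Longrightarrow> cring (Qp p)"
  unfolding Qp_def by (intro ideal.quotient_is_cring ideal_padic_null cring_padic_Cauchy_ring)

lemma carrier_Qp: "carrier (Qp p) = padic_class p ` padic_Cauchy p"
  unfolding Qp_def padic_class_def
  by (auto simp: FactRing_def A_RCOSETS_def') (auto simp: padic_Cauchy_ring_def)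

lemma padic_class_hom:
  assumes "prime p"
  shows "ring_hom_cring (padic_Cauchy_ring p) (Qp p) (padic_class p)"
  unfolding Qp_def padic_class_def
  using ideal.rcos_ring_hom_cring[OF ideal_padic_null cring_padic_Cauchy_ring] assms by blast

lemma padic_class_add:
  assumes "prime p" "X \<in> padic_Cauchy p" "Y \<in> padic_Cauchy p"
  shows "padic_class p X \<oplus>\<^bsub>Qp p\<^esub> padic_class p Y = padic_class p (\<lambda>n. X n + Y n)"
proof -
  interpret ring_hom_cring "padic_Cauchy_ring p" "Qp p" "padic_class p"
    by (rule padic_class_hom) fact
  show ?thesis using hom_add[of X Y] assms by (simp add: padic_Cauchy_ring_def)
qed

lemma padic_class_mult:
  assumes "prime p" "X \<in> padic_Cauchy p" "Y \<in> padic_Cauchy p"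
  shows "padic_class p X \<otimes>\<^bsub>Qp p\<^esub> padic_class p Y = padic_class p (\<lambda>n. X n * Y n)"
proof -
  interpret ring_hom_cring "padic_Cauchy_ring p" "Qp p" "padic_class p"
    by (rule padic_class_hom) fact
  show ?thesis using hom_mult[of X Y] assms by (simp add: padic_Cauchy_ring_def)
qed

lemma padic_class_0: "prime p \<Longrightarrow> \<zero>\<^bsub>Qp p\<^esub> = padic_class p (\<lambda>n. 0)"
  using ring_hom_cring.hom_zero[OF padic_class_hom, of p] by (simp add: padic_Cauchy_ring_def)

lemma padic_class_1: "prime p \<Longrightarrow> \<one>\<^bsub>Qp p\<^esub> = padic_class p (\<lambda>n. 1)"
  using ring_hom_one[OF ring_hom_cring.homh[OF padic_class_hom], of p]
  by (simp add: padic_Cauchy_ring_def)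

lemma padic_class_uminus:
  assumes "prime p" "X \<in> padic_Cauchy p"
  shows "\<ominus>\<^bsub>Qp p\<^esub> padic_class p X = padic_class p (\<lambda>n. - X n)"
proof -
  interpret ring_hom_cring "padic_Cauchy_ring p" "Qp p" "padic_class p"
    by (rule padic_class_hom) fact
  show ?thesis
    using hom_a_inv[of X] padic_Cauchy_ring_a_inv assms by (simp add: padic_Cauchy_ring_def)
qed

lemma padic_class_diff:
  assumes "prime p" "X \<in> padic_Cauchy p" "Y \<in> padic_Cauchy p"
  shows "padic_class p X \<ominus>\<^bsub>Qp p\<^esub> padic_class p Y = padic_class p (\<lambda>n. X n - Y n)"
  using assms padic_class_add[of p X "\<lambda>n. - Y n"]
  by (simp add: a_minus_def padic_class_uminus padic_Cauchy_uminus)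

lemma padic_class_eq_iff:
  assumes "prime p" "X \<in> padic_Cauchy p" "Y \<in> padic_Cauchy p"
  shows "padic_class p X = padic_class p Y \<longleftrightarrow> (\<lambda>n. X n - Y n) \<in> padic_null p"
proof -
  interpret cring "padic_Cauchy_ring p" by (rule cring_padic_Cauchy_ring) fact
  have "X \<ominus>\<^bsub>padic_Cauchy_ring p\<^esub> Y = (\<lambda>n. X n - Y n)"
    using assms padic_Cauchy_ring_a_inv[of p Y] by (simp add: a_minus_def padic_Cauchy_ring_def)
  then show ?thesis
    using quotient_eq_iff_same_a_r_cos[OF ideal_padic_null[OF assms(1)], of X Y] assms
    by (simp add: padic_class_def padic_Cauchy_ring_def)
qed

lemma mem_padic_class:
  "Y \<in> padic_class p X \<longleftrightarrow> (\<lambda>n. Y n - X n) \<in> padic_null p"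
proof
  assume "Y \<in> padic_class p X"
  then show "(\<lambda>n. Y n - X n) \<in> padic_null p"
    by (auto simp: padic_class_def a_r_coset_def r_coset_def padic_Cauchy_ring_def)
next
  assume "(\<lambda>n. Y n - X n) \<in> padic_null p"
  moreover have "Y = (\<lambda>n. (\<lambda>n. Y n - X n) n + X n)" by simp
  ultimately show "Y \<in> padic_class p X"
    unfolding padic_class_def a_r_coset_def r_coset_def padic_Cauchy_ring_def
    by (intro UN_I[of "\<lambda>n. Y n - X n"]) auto
qed

text \<open>Two representatives differ by a null sequence and the absolute value is 1-Lipschitz, so
  the limit is independent of the representative. This justifies the definite description in
  \<open>Qp_abs\<close>.\<close>

lemma Qp_abs_class:
  assumes p: "prime p" and X: "X \<in> padic_Cauchy p"
  shows "(\<lambda>n. padic_abs p (X n)) \<longlonglongrightarrow> Qp_abs p (padic_class p X)"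
proof -
  obtain r where r: "(\<lambda>n. padic_abs p (X n)) \<longlonglongrightarrow> r"
    using convergent_padic_abs[OF p X] by (auto simp: convergent_def)
  have XX: "X \<in> padic_class p X" by (simp add: mem_padic_class padic_null_def)
  have "(\<lambda>n. padic_abs p (Y n)) \<longlonglongrightarrow> r" if "Y \<in> padic_class p X" for Y
  proof -
    have "(\<lambda>n. padic_abs p (Y n - X n)) \<longlonglongrightarrow> 0"
      using that by (simp add: mem_padic_class padic_null_def)
    then have "(\<lambda>n. padic_abs p (Y n) - padic_abs p (X n)) \<longlonglongrightarrow> 0"
      by (rule Lim_null_comparison[rotated]) (simp add: abs_padic_abs_diff[OF p])
    from tendsto_add[OF this r] show ?thesis by simp
  qed
  then have "Qp_abs p (padic_class p X) = r"
    unfolding Qp_abs_def using XX r by (intro the_equality) (auto intro: LIMSEQ_unique)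
  then show ?thesis using r by simp
qed

lemma Qp_cases:
  assumes "x \<in> carrier (Qp p)"
  obtains X where "X \<in> padic_Cauchy p" "x = padic_class p X"
  using assms by (auto simp: carrier_Qp)

lemma padic_class_closed [intro, simp]: "X \<in> padic_Cauchy p \<Longrightarrow> padic_class p X \<in> carrier (Qp p)"
  by (auto simp: carrier_Qp)

lemma Qp_abs_const [simp]: "prime p \<Longrightarrow> Qp_abs p (padic_class p (\<lambda>n. q)) = padic_abs p q"
  using LIMSEQ_unique[OF Qp_abs_class tendsto_const] by simp

lemma Qp_abs_nonneg:
  assumes "prime p" "x \<in> carrier (Qp p)" shows "Qp_abs p x \<ge> 0"
  using assms by (auto elim!: Qp_cases intro: LIMSEQ_le_const[OF Qp_abs_class])

lemma Qp_abs_add: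
  assumes p: "prime p" and "x \<in> carrier (Qp p)" "y \<in> carrier (Qp p)"
  shows "Qp_abs p (x \<oplus>\<^bsub>Qp p\<^esub> y) \<le> max (Qp_abs p x) (Qp_abs p y)"
proof -
  obtain X where X: "X \<in> padic_Cauchy p" "x = padic_class p X" by (rule Qp_cases[OF assms(2)])
  obtain Y where Y: "Y \<in> padic_Cauchy p" "y = padic_class p Y" by (rule Qp_cases[OF assms(3)])
  show ?thesis
    unfolding X(2) Y(2) padic_class_add[OF p X(1) Y(1)]
    by (rule LIMSEQ_le[OF Qp_abs_class tendsto_max[OF Qp_abs_class Qp_abs_class]])
      (use X Y p in \<open>auto intro: padic_Cauchy_add padic_abs_add\<close>)
qed

lemma Qp_abs_mult:
  assumes p: "prime p" and "x \<in> carrier (Qp p)" "y \<in> carrier (Qp p)"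
  shows "Qp_abs p (x \<otimes>\<^bsub>Qp p\<^esub> y) = Qp_abs p x * Qp_abs p y"
proof -
  obtain X where X: "X \<in> padic_Cauchy p" "x = padic_class p X" by (rule Qp_cases[OF assms(2)])
  obtain Y where Y: "Y \<in> padic_Cauchy p" "y = padic_class p Y" by (rule Qp_cases[OF assms(3)])
  have "(\<lambda>n. padic_abs p (X n * Y n)) \<longlonglongrightarrow> Qp_abs p x * Qp_abs p y"
    unfolding X(2) Y(2) padic_abs_mult[OF p] using X Y p by (intro tendsto_mult Qp_abs_class)
  moreover have "(\<lambda>n. padic_abs p (X n * Y n)) \<longlonglongrightarrow> Qp_abs p (x \<otimes>\<^bsub>Qp p\<^esub> y)"
    unfolding X(2) Y(2) padic_class_mult[OF p X(1) Y(1)]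
    using X Y p by (intro Qp_abs_class padic_Cauchy_mult)
  ultimately show ?thesis by (rule LIMSEQ_unique[symmetric])
qed

section \<open>The p-adic ultrametric and the ring of p-adic integers\<close>

lemma Qp_dist_class:
  assumes "prime p" "X \<in> padic_Cauchy p" "Y \<in> padic_Cauchy p"
  shows "(\<lambda>n. padic_abs p (X n - Y n)) \<longlonglongrightarrow> Qp_dist p (padic_class p X) (padic_class p Y)"
  unfolding Qp_dist_def using assms by (simp add: padic_class_diff Qp_abs_class padic_Cauchy_diff)

lemma Qp_dist_le:
  assumes "prime p" "X \<in> padic_Cauchy p" "Y \<in> padic_Cauchy p"
    and "\<And>n. n \<ge> N \<Longrightarrow> padic_abs p (X n - Y n) \<le> B"
  shows "Qp_dist p (padic_class p X) (padic_class p Y) \<le> B"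
  using LIMSEQ_le_const2[OF Qp_dist_class[OF assms(1-3)]] assms(4) by blast

lemma Qp_dist_nonneg: "prime p \<Longrightarrow> Qp_dist p x y \<ge> 0"
  unfolding Qp_dist_def
  by (auto intro!: Qp_abs_nonneg abelian_group.minus_closed ring.is_abelian_group cring.axioms(1) cring_Qp)

lemma Qp_dist_commute: "prime p \<Longrightarrow> Qp_dist p x y = Qp_dist p y x"
proof (cases "x \<in> carrier (Qp p) \<and> y \<in> carrier (Qp p)")
  case True
  assume p: "prime p"
  from True obtain X Y where X: "X \<in> padic_Cauchy p" "x = padic_class p X"
    and Y: "Y \<in> padic_Cauchy p" "y = padic_class p Y" by (auto elim!: Qp_cases)
  show ?thesis
    using Qp_dist_class[OF p X(1) Y(1)] Qp_dist_class[OF p Y(1) X(1)] X Y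
    by (simp add: padic_abs_minus_commute[OF p, of "Y _"] LIMSEQ_unique)
qed (auto simp: Qp_dist_def)

lemma Qp_dist_eq_0_iff:
  assumes p: "prime p" and "x \<in> carrier (Qp p)" "y \<in> carrier (Qp p)"
  shows "Qp_dist p x y = 0 \<longleftrightarrow> x = y"
proof -
  obtain X where X: "X \<in> padic_Cauchy p" "x = padic_class p X" by (rule Qp_cases[OF assms(2)])
  obtain Y where Y: "Y \<in> padic_Cauchy p" "y = padic_class p Y" by (rule Qp_cases[OF assms(3)])
  show ?thesis
    using Qp_dist_class[OF p X(1) Y(1)] unfolding X(2) Y(2) padic_class_eq_iff[OF p X(1) Y(1)]
    by (auto simp: padic_null_def dest: LIMSEQ_unique)
qed

lemma Qp_dist_ultrametric:
  assumes p: "prime p" and "x \<in> carrier (Qp p)" "y \<in> carrier (Qp p)" "z \<in> carrier (Qp p)"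
  shows "Qp_dist p x z \<le> max (Qp_dist p x y) (Qp_dist p y z)"
proof -
  obtain X where X: "X \<in> padic_Cauchy p" "x = padic_class p X" by (rule Qp_cases[OF assms(2)])
  obtain Y where Y: "Y \<in> padic_Cauchy p" "y = padic_class p Y" by (rule Qp_cases[OF assms(3)])
  obtain Z where Z: "Z \<in> padic_Cauchy p" "z = padic_class p Z" by (rule Qp_cases[OF assms(4)])
  have "padic_abs p (X n - Z n) \<le> max (padic_abs p (X n - Y n)) (padic_abs p (Y n - Z n))" for n
    using padic_abs_add[OF p, of "X n - Y n" "Y n - Z n"] by simp
  then show ?thesis
    unfolding X(2) Y(2) Z(2)
    by (intro LIMSEQ_le[OF Qp_dist_class tendsto_max[OF Qp_dist_class Qp_dist_class]])
      (use X Y Z p in auto)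
qed

lemma Zp_subset_Qp: "carrier (Zp_ring p) \<subseteq> carrier (Qp p)"
  by (auto simp: Zp_ring_def)

lemma Zp_imp_Qp: "x \<in> carrier (Zp_ring p) \<Longrightarrow> x \<in> carrier (Qp p)"
  by (simp add: Zp_ring_def)

lemma subring_Zp:
  assumes p: "prime p" shows "subring (carrier (Zp_ring p)) (Qp p)"
proof -
  interpret cring "Qp p" by (rule cring_Qp[OF p])
  show ?thesis
  proof (rule subringI)
    show "carrier (Zp_ring p) \<subseteq> carrier (Qp p)" by (rule Zp_subset_Qp)
    show "\<one>\<^bsub>Qp p\<^esub> \<in> carrier (Zp_ring p)"
      using p by (auto simp: Zp_ring_def padic_class_1)
  next
    fix x assume x: "x \<in> carrier (Zp_ring p)"
    then obtain X where X: "X \<in> padic_Cauchy p" "x = padic_class p X"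
      by (auto simp: Zp_ring_def elim: Qp_cases)
    have "Qp_abs p (\<ominus>\<^bsub>Qp p\<^esub> x) = Qp_abs p x"
      unfolding X(2) padic_class_uminus[OF p X(1)]
      using Qp_abs_class[OF p padic_Cauchy_uminus[OF p X(1)]] Qp_abs_class[OF p X(1)] p
      by (auto dest: LIMSEQ_unique)
    then show "\<ominus>\<^bsub>Qp p\<^esub> x \<in> carrier (Zp_ring p)" using x by (simp add: Zp_ring_def)
  next
    fix x y assume xy: "x \<in> carrier (Zp_ring p)" "y \<in> carrier (Zp_ring p)"
    then show "x \<otimes>\<^bsub>Qp p\<^esub> y \<in> carrier (Zp_ring p)"
      by (auto simp: Zp_ring_def Qp_abs_mult p Qp_abs_nonneg intro: mult_le_one)
    show "x \<oplus>\<^bsub>Qp p\<^esub> y \<in> carrier (Zp_ring p)"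
      using xy Qp_abs_add[OF p, of x y] by (auto simp: Zp_ring_def)
  qed
qed

lemma ring_Zp: "prime p \<Longrightarrow> ring (Zp_ring p)"
  using ring.subring_is_ring[OF cring.axioms(1)[OF cring_Qp] subring_Zp, of p]
  by (simp add: Zp_ring_def)

lemma Metric_space_Zp: "prime p \<Longrightarrow> Metric_space (carrier (Zp_ring p)) (Qp_dist p)"
proof
  fix x y z assume "prime p" "x \<in> carrier (Zp_ring p)" "y \<in> carrier (Zp_ring p)" "z \<in> carrier (Zp_ring p)"
  then show "Qp_dist p x z \<le> Qp_dist p x y + Qp_dist p y z"
    using Qp_dist_ultrametric[of p x y z] Qp_dist_nonneg[of p x y] Qp_dist_nonneg[of p y z]
      Zp_imp_Qp by fastforce
qed (auto simp: Qp_dist_nonneg Qp_dist_commute Qp_dist_eq_0_iff Zp_imp_Qp)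

lemma topspace_Zp: "prime p \<Longrightarrow> topspace (Zp_top p) = carrier (Zp_ring p)"
  unfolding Zp_top_def by (intro Metric_space.topspace_mtopology Metric_space_Zp)

section \<open>Approximation of p-adic integers by natural numbers\<close>

lemma rat_padic_integer_approx:
  assumes p: "prime p" and q: "padic_abs p q \<le> 1"
  obtains a :: nat where "padic_abs p (q - of_nat a) \<le> inverse (real p ^ n)"
proof -
  obtain u v where quv: "quotient_of q = (u, v)" by fastforce
  then have uv: "q = of_int u / of_int v" "v > 0" "coprime u v"
    using quotient_of_div quotient_of_denom_pos quotient_of_coprime by auto
  have mult: "padic_abs p (of_int u) = padic_abs p q * padic_abs p (of_int v)"
    using uv by (simp add: padic_abs_mult[OF p, symmetric])
  \<comment> \<open>The absolute value of \<open>u\<close> is at most that of \<open>v\<close>, so a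
    factor p of the denominator would also divide the numerator of the reduced fraction.\<close>
  have v: "\<not> int p dvd v"
  proof
    assume v: "int p dvd v"
    then have "padic_abs p (of_int v) \<le> inverse (real p ^ 1)"
      by (subst padic_abs_of_int_le_iff[OF p]) simp
    then have "padic_abs p (of_int u) \<le> inverse (real p ^ 1)"
      using mult q by (metis dual_order.trans mult_left_le_one_le padic_abs_nonneg)
    then have "int p dvd u"
      by (subst (asm) padic_abs_of_int_le_iff[OF p]) simp
    then show False using v uv(3) p by (metis coprime_common_divisor not_prime_unit prime_int_iff' prime_nat_int_transfer)
  qed
  then have v1: "padic_abs p (of_int v) = 1"
    using padic_abs_divide[OF p, of v 1] uv by (simp add: not_dvd_imp_multiplicity_0)
  have "coprime v (int p ^ n)"
    using v p prime_imp_coprime[of "int p" v] by (simp add: coprime_commute)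
  then obtain s where s: "[v * s = 1] (mod (int p ^ n))"
    using cong_solve_coprime_int by blast
  \<comment> \<open>With \<open>s\<close> inverse to \<open>v\<close> modulo p^n, the product u s
    stands for u/v; its residue is nonnegative and so yields a natural number.\<close>
  define a where "a = nat ((u * s) mod (int p ^ n))"
  have pn: "int p ^ n > 0" using p by (simp add: prime_gt_0_nat)
  have a: "int a = (u * s) mod (int p ^ n)" using pn by (simp add: a_def)
  have "[v * int a = v * (u * s)] (mod (int p ^ n))" unfolding a by (intro cong_mult) auto
  also have "v * (u * s) = u * (v * s)" by simp
  also have "[u * (v * s) = u * 1] (mod (int p ^ n))" by (intro cong_mult s) auto
  finally have "int p ^ n dvd u - v * int a"
    by (simp add: cong_iff_dvd_diff dvd_diff_commute)
  then have "padic_abs p (of_int (u - v * int a)) \<le> inverse (real p ^ n)"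
    by (subst padic_abs_of_int_le_iff[OF p])
  \<comment> \<open>The factor \<open>v\<close> has absolute value 1, so clearing the denominator
    leaves the size of the error unchanged.\<close>
  moreover have "of_int (u - v * int a) = (q - of_nat a) * of_int v"
    using uv by (simp add: algebra_simps)
  ultimately have "padic_abs p (q - of_nat a) \<le> inverse (real p ^ n)"
    using v1 by (simp add: padic_abs_mult[OF p])
  then show ?thesis by (rule that)
qed

lemma inverse_prime_power_tendsto: "prime p \<Longrightarrow> (\<lambda>n. inverse (real p ^ n)) \<longlonglongrightarrow> 0"
  using LIMSEQ_inverse_realpow_zero[of "real p"] prime_gt_1_nat[of p] by simp

text \<open>These representatives let properties of a polynomial on the naturals extend to Z_p. From
  some index on, the terms of a representing sequence have absolute value at most 1; moving the n-th
  of them to a natural number within p^-n is a null change.\<close>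

lemma Zp_nat_representative:
  assumes p: "prime p" and x: "x \<in> carrier (Zp_ring p)"
  obtains A :: "nat \<Rightarrow> nat" where "(\<lambda>n. of_nat (A n)) \<in> padic_Cauchy p"
    "x = padic_class p (\<lambda>n. of_nat (A n))"
proof -
  obtain X where X: "X \<in> padic_Cauchy p" and xX: "x = padic_class p X" and le: "Qp_abs p x \<le> 1"
    using x by (auto simp: Zp_ring_def elim: Qp_cases)
  obtain N where N: "\<forall>m\<ge>N. \<forall>n\<ge>N. padic_abs p (X m - X n) < 1"
    using padic_CauchyD[OF X, of 1] by auto
  have X1: "padic_abs p (X n) \<le> 1" if n: "n \<ge> N" for n
  proof (rule ccontr)
    assume "\<not> padic_abs p (X n) \<le> 1"
    then have gt: "padic_abs p (X n) > 1" by simp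
    \<comment> \<open>Beyond \<open>N\<close> the terms differ by less than 1, so a term of absolute
      value above 1 cannot be dominated by the difference; the strong triangle inequality then
      bounds it by every X m, hence by the limit.\<close>
    have "padic_abs p (X n) \<le> padic_abs p (X m)" if m: "m \<ge> N" for m
      using padic_abs_add[OF p, of "X n - X m" "X m"] N gt n m
      by (smt (verit, best) diff_add_cancel)
    then have "padic_abs p (X n) \<le> Qp_abs p x"
      unfolding xX using LIMSEQ_le_const[OF Qp_abs_class[OF p X]] by blast
    then show False using gt le by simp
  qed
  \<comment> \<open>The condition on X n stays inside the choice because the finitely many terms
    before \<open>N\<close> may violate it; they do not affect the limit.\<close>
  have "\<exists>A::nat \<Rightarrow> nat. \<forall>n. padic_abs p (X n) \<le> 1 \<longrightarrow> padic_abs p (X n - of_nat (A n)) \<le> inverse (real p ^ n)"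
    by (intro choice allI) (metis rat_padic_integer_approx[OF p])
  then obtain A :: "nat \<Rightarrow> nat" where
    A: "\<And>n. padic_abs p (X n) \<le> 1 \<Longrightarrow> padic_abs p (X n - of_nat (A n)) \<le> inverse (real p ^ n)"
    by blast
  have "(\<lambda>n. padic_abs p (X n - of_nat (A n))) \<longlonglongrightarrow> 0"
    by (rule tendsto_sandwich[OF _ _ tendsto_const inverse_prime_power_tendsto[OF p]])
      (use A X1 in \<open>auto simp: eventually_sequentially\<close>)
  then have null: "(\<lambda>n. X n - of_nat (A n)) \<in> padic_null p" by (simp add: padic_null_def)
  then have C: "(\<lambda>n. of_nat (A n)) \<in> padic_Cauchy p"
    using padic_Cauchy_diff[OF p X, of "\<lambda>n. X n - of_nat (A n)"] padic_null_subset_Cauchy[OF p] by auto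
  moreover have "x = padic_class p (\<lambda>n. of_nat (A n))"
    unfolding xX using padic_class_eq_iff[OF p X C] null by simp
  ultimately show ?thesis by (rule that)
qed

lemma padic_class_const_of_nat_Zp: "prime p \<Longrightarrow> padic_class p (\<lambda>n. of_nat m) \<in> carrier (Zp_ring p)"
  by (simp add: Zp_ring_def padic_abs_of_nat_le_1)

text \<open>The approximant is a single term of the representing sequence of naturals, taken far
  enough out.\<close>

lemma Zp_nat_dense:
  assumes p: "prime p" and x: "x \<in> carrier (Zp_ring p)" and e: "e > 0"
  obtains m :: nat where "Qp_dist p x (padic_class p (\<lambda>n. of_nat m)) \<le> e"
proof -
  obtain A :: "nat \<Rightarrow> nat" where A: "(\<lambda>n. of_nat (A n)) \<in> padic_Cauchy p"
    "x = padic_class p (\<lambda>n. of_nat (A n))" by (rule Zp_nat_representative[OF p x])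
  obtain N where N: "\<forall>m\<ge>N. \<forall>n\<ge>N. padic_abs p (of_nat (A m) - of_nat (A n)) < e"
    using padic_CauchyD[OF A(1) e] by auto
  have "Qp_dist p x (padic_class p (\<lambda>n. of_nat (A N))) \<le> e"
    unfolding A(2) by (rule Qp_dist_le[OF p A(1), of _ N]) (use N in \<open>auto intro: less_imp_le\<close>)
  then show ?thesis by (rule that)
qed

section \<open>Polynomials on the p-adic integers\<close>

lemma padic_Cauchy_power:
  "prime p \<Longrightarrow> X \<in> padic_Cauchy p \<Longrightarrow> (\<lambda>n. X n ^ i) \<in> padic_Cauchy p"
  by (induction i) (auto intro: padic_Cauchy_mult)

lemma padic_Cauchy_sum:
  "prime p \<Longrightarrow> (\<And>i. i \<in> I \<Longrightarrow> F i \<in> padic_Cauchy p) \<Longrightarrow> (\<lambda>n. \<Sum>i\<in>I. F i n) \<in> padic_Cauchy p"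
  by (induction I rule: infinite_finite_induct) (auto intro: padic_Cauchy_add)

lemma padic_Cauchy_poly:
  "prime p \<Longrightarrow> X \<in> padic_Cauchy p \<Longrightarrow> (\<lambda>n. poly f (X n)) \<in> padic_Cauchy p"
  unfolding poly_altdef
  by (intro padic_Cauchy_sum padic_Cauchy_mult padic_Cauchy_const padic_Cauchy_power)

lemma padic_class_power:
  assumes p: "prime p" and X: "X \<in> padic_Cauchy p"
  shows "padic_class p X [^]\<^bsub>Qp p\<^esub> i = padic_class p (\<lambda>n. X n ^ i)"
proof (induction i)
  case (Suc i)
  then show ?case
    using padic_class_mult[OF p padic_Cauchy_power[OF p X] X, of i] by (simp add: mult.commute)
qed (simp add: padic_class_1[OF p])

lemma padic_class_finsum:
  assumes p: "prime p" and I: "finite I" and F: "\<And>i. i \<in> I \<Longrightarrow> F i \<in> padic_Cauchy p"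
  shows "(\<Oplus>\<^bsub>Qp p\<^esub>i\<in>I. padic_class p (F i)) = padic_class p (\<lambda>n. \<Sum>i\<in>I. F i n)"
proof -
  interpret cring "Qp p" by (rule cring_Qp[OF p])
  show ?thesis
    using I F
  proof (induction I)
    case (insert i I)
    then show ?case
      using padic_class_add[OF p, of "F i" "\<lambda>n. \<Sum>i\<in>I. F i n"] padic_Cauchy_sum[OF p, of I F]
      by (subst finsum_insert) auto
  qed (simp add: padic_class_0[OF p])
qed

lemma Qp_eval_class:
  assumes p: "prime p" and X: "X \<in> padic_Cauchy p"
  shows "Qp_eval p f (padic_class p X) = padic_class p (\<lambda>n. poly f (X n))"
proof -
  have "Qp_eval p f (padic_class p X) =
      (\<Oplus>\<^bsub>Qp p\<^esub>i\<in>{..degree f}. padic_class p (\<lambda>n. poly.coeff f i * X n ^ i))"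
    unfolding Qp_eval_def Qp_of_rat_eq padic_class_power[OF p X]
    by (subst padic_class_mult[OF p padic_Cauchy_const padic_Cauchy_power[OF p X]]) (rule refl)
  also have "\<dots> = padic_class p (\<lambda>n. poly f (X n))"
    unfolding poly_altdef
    by (intro padic_class_finsum p padic_Cauchy_mult padic_Cauchy_power X padic_Cauchy_const) simp
  finally show ?thesis .
qed

text \<open>Bound and Lipschitz estimate are proved together: the induction step writes x f(x) - y
  f(y) as x (f(x) - f(y)) + (x - y) f(y), and the second summand requires the bound.\<close>

lemma padic_poly_Lipschitz:
  assumes p: "prime p"
  shows "\<exists>C\<ge>0. \<forall>x y. padic_abs p x \<le> 1 \<longrightarrow> padic_abs p y \<le> 1 \<longrightarrow>
    padic_abs p (poly f x) \<le> C \<and> padic_abs p (poly f x - poly f y) \<le> C * padic_abs p (x - y)"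
proof (induction f)
  case 0
  show ?case by (intro exI[of _ 0]) simp
next
  case (pCons a f)
  then obtain C where C: "C \<ge> 0" and
    bd: "\<And>x. padic_abs p x \<le> 1 \<Longrightarrow> padic_abs p (poly f x) \<le> C" and
    lip: "\<And>x y. padic_abs p x \<le> 1 \<Longrightarrow> padic_abs p y \<le> 1 \<Longrightarrow>
      padic_abs p (poly f x - poly f y) \<le> C * padic_abs p (x - y)"
    by (metis padic_abs_0 zero_le_one)
  show ?case
  proof (intro exI[of _ "max C (padic_abs p a)"] conjI allI impI)
    fix x y assume x: "padic_abs p x \<le> 1" and y: "padic_abs p y \<le> 1"
    have xf: "padic_abs p (x * poly f x) \<le> C"
      unfolding padic_abs_mult[OF p] using mult_mono[OF x bd[OF x]] C by simp
    then show "padic_abs p (poly (pCons a f) x) \<le> max C (padic_abs p a)"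
      using padic_abs_add[OF p, of a "x * poly f x"] by auto
    have "padic_abs p (poly (pCons a f) x - poly (pCons a f) y) \<le>
        max (padic_abs p x * padic_abs p (poly f x - poly f y)) (padic_abs p (x - y) * padic_abs p (poly f y))"
      using padic_abs_add[OF p, of "x * (poly f x - poly f y)" "(x - y) * poly f y"]
      by (simp add: padic_abs_mult[OF p, symmetric] algebra_simps)
    moreover have "padic_abs p x * padic_abs p (poly f x - poly f y) \<le> C * padic_abs p (x - y)"
      using mult_mono[OF x lip[OF x y]] C by simp
    moreover have "padic_abs p (x - y) * padic_abs p (poly f y) \<le> C * padic_abs p (x - y)"
      using mult_left_mono[OF bd[OF y], of "padic_abs p (x - y)"] by (simp add: mult.commute)
    moreover have "C * padic_abs p (x - y) \<le> max C (padic_abs p a) * padic_abs p (x - y)"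
      by (intro mult_right_mono) auto
    ultimately show "padic_abs p (poly (pCons a f) x - poly (pCons a f) y) \<le>
        max C (padic_abs p a) * padic_abs p (x - y)" by linarith
  qed (use C in auto)
qed

lemma Qp_eval_Lipschitz:
  assumes p: "prime p"
  obtains C where "C > 0"
    "\<And>x y. x \<in> carrier (Zp_ring p) \<Longrightarrow> y \<in> carrier (Zp_ring p) \<Longrightarrow>
      Qp_dist p (Qp_eval p f x) (Qp_eval p f y) \<le> C * Qp_dist p x y"
proof -
  obtain C where C: "C \<ge> 0" and
    lip: "\<And>x y. padic_abs p x \<le> 1 \<Longrightarrow> padic_abs p y \<le> 1 \<Longrightarrow>
      padic_abs p (poly f x - poly f y) \<le> C * padic_abs p (x - y)"
    using padic_poly_Lipschitz[OF p, of f] by blast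
  \<comment> \<open>The constant obtained so far may be 0; adding 1 makes it positive, so that radii
    can be divided by it.\<close>
  have "Qp_dist p (Qp_eval p f x) (Qp_eval p f y) \<le> (C + 1) * Qp_dist p x y"
    if x: "x \<in> carrier (Zp_ring p)" and y: "y \<in> carrier (Zp_ring p)" for x y
  proof -
    obtain A :: "nat \<Rightarrow> nat" where A: "(\<lambda>n. of_nat (A n)) \<in> padic_Cauchy p"
      "x = padic_class p (\<lambda>n. of_nat (A n))" by (rule Zp_nat_representative[OF p x])
    obtain B :: "nat \<Rightarrow> nat" where B: "(\<lambda>n. of_nat (B n)) \<in> padic_Cauchy p"
      "y = padic_class p (\<lambda>n. of_nat (B n))" by (rule Zp_nat_representative[OF p y])
    have "Qp_dist p (Qp_eval p f x) (Qp_eval p f y) \<le> C * Qp_dist p x y"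
      unfolding A(2) B(2) Qp_eval_class[OF p A(1)] Qp_eval_class[OF p B(1)]
      by (rule LIMSEQ_le[OF Qp_dist_class tendsto_mult[OF tendsto_const Qp_dist_class]])
        (use p A B padic_Cauchy_poly in \<open>auto intro: lip padic_abs_of_nat_le_1\<close>)
    also have "\<dots> \<le> (C + 1) * Qp_dist p x y"
      by (intro mult_right_mono) (auto simp: Qp_dist_nonneg p)
    finally show ?thesis .
  qed
  then show ?thesis using that[of "C + 1"] C by simp
qed

text \<open>Integers have absolute value at most 1 at every prime, and this bound passes to the
  limit along a sequence of naturals representing \<open>x\<close>. The hypothesis on
  \<open>f\<close> does not mention \<open>p\<close>, so one polynomial serves all primes.\<close>

lemma Qp_eval_Zp:
  assumes p: "prime p" and f: "\<And>m::nat. poly f (of_nat m) \<in> \<int>"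
    and x: "x \<in> carrier (Zp_ring p)"
  shows "Qp_eval p f x \<in> carrier (Zp_ring p)"
proof -
  obtain A :: "nat \<Rightarrow> nat" where A: "(\<lambda>n. of_nat (A n)) \<in> padic_Cauchy p"
    "x = padic_class p (\<lambda>n. of_nat (A n))" by (rule Zp_nat_representative[OF p x])
  have "padic_abs p (poly f (of_nat (A n))) \<le> 1" for n
    using f[of "A n"] by (auto elim!: Ints_cases simp: padic_abs_of_int_le_1[OF p])
  then have "Qp_abs p (Qp_eval p f x) \<le> 1"
    unfolding A(2) Qp_eval_class[OF p A(1)]
    using LIMSEQ_le_const2[OF Qp_abs_class[OF p padic_Cauchy_poly[OF p A(1)]]] by blast
  then show ?thesis
    unfolding A(2) Qp_eval_class[OF p A(1)]
    by (simp add: Zp_ring_def padic_Cauchy_poly[OF p A(1)])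
qed

section \<open>Integer-valued polynomials with prescribed residues\<close>

text \<open>Powers up to p^n divide p^n m, hence divide the difference exactly when they divide
  \<open>j\<close>. Higher powers divide neither side, because p^n already divides neither.\<close>

lemma multiplicity_prime_power_diff:
  fixes p m j n :: nat
  assumes j: "0 < j" "j < p ^ n" "j < p ^ n * m"
  shows "multiplicity p (p ^ n * m - j) = multiplicity p j"
proof (rule multiplicity_cong)
  fix r
  show "p ^ r dvd p ^ n * m - j \<longleftrightarrow> p ^ r dvd j"
  proof (cases "r \<le> n")
    case True
    then have "p ^ r dvd p ^ n * m" by (simp add: le_imp_power_dvd)
    then show ?thesis using j by (metis dvd_diff_nat dvd_diffD1 less_imp_le)
  next
    case False
    then have "p ^ n dvd p ^ r" by (simp add: le_imp_power_dvd)
    moreover have "\<not> p ^ n dvd j" using j nat_dvd_not_less by blast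
    moreover have "p ^ n dvd j" if "p ^ n dvd p ^ n * m - j"
      using that j by (metis dvd_diffD1 dvd_triv_left less_imp_le)
    ultimately show ?thesis using dvd_trans by blast
  qed
qed

text \<open>With N = p^n m, passing from j to j + 1 multiplies C(N - 1, j) by (N - (j + 1)) / (j +
  1), whose numerator and denominator have equal multiplicity of p. Starting from 1, no factor p
  ever appears.\<close>

lemma not_dvd_binomial_prime_power:
  fixes p :: nat
  assumes p: "prime p" and m: "m > 0" and j: "j < p ^ n"
  shows "\<not> p dvd ((p ^ n * m - 1) choose j)"
  using j
proof (induction j)
  case (Suc j)
  define N where "N = p ^ n * m"
  have "p ^ n \<le> N" using m by (simp add: N_def)
  then have jN: "Suc j < N" using Suc.prems by linarith
  have "Suc j * ((N - 1) choose Suc j) = (N - Suc j) * ((N - 1) choose j)"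
    using jN by (metis Suc_pred binomial_absorb_comp diff_Suc_eq_diff_pred gr_implies_not0 mult.commute
        neq0_conv binomial_absorption)
  moreover have "(N - 1) choose Suc j > 0" "(N - 1) choose j > 0" using jN by auto
  moreover have "multiplicity p (N - Suc j) = multiplicity p (Suc j)"
    using multiplicity_prime_power_diff[of "Suc j" p n m] Suc.prems jN by (simp add: N_def)
  ultimately have "multiplicity p ((N - 1) choose Suc j) = multiplicity p ((N - 1) choose j)"
    using p jN prime_elem_multiplicity_mult_distrib[of p "Suc j" "(N - 1) choose Suc j"]
      prime_elem_multiplicity_mult_distrib[of p "N - Suc j" "(N - 1) choose j"]
    by simp
  moreover have "multiplicity p ((N - 1) choose j) = 0"
    using Suc by (simp add: N_def not_dvd_imp_multiplicity_0)
  ultimately show ?case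
    using p \<open>(N - 1) choose Suc j > 0\<close>
    by (metis N_def bot_nat_0.not_eq_extremum multiplicity_eq_zero_iff not_prime_unit)
qed (use p in \<open>auto dest: prime_gt_1_nat\<close>)

text \<open>If p did not divide the coefficient, the identity (y + 1) C(y, p^n - 1) = p^n C(y + 1,
  p^n) would push all of p^n into y + 1.\<close>

lemma dvd_binomial_prime_power:
  fixes p :: nat
  assumes p: "prime p" and y: "\<not> p ^ n dvd Suc y"
  shows "p dvd (y choose (p ^ n - 1))"
proof (rule ccontr)
  assume "\<not> p dvd (y choose (p ^ n - 1))"
  then have cop: "coprime (p ^ n) (y choose (p ^ n - 1))"
    using p by (simp add: prime_imp_coprime)
  have "p ^ n > 0" using p by (simp add: prime_gt_0_nat)
  then have "Suc y * (y choose (p ^ n - 1)) = p ^ n * (Suc y choose p ^ n)"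
    using Suc_times_binomial_eq[of y "p ^ n - 1"] by (simp add: mult.commute)
  then have "p ^ n dvd Suc y * (y choose (p ^ n - 1))" by simp
  then show False using y cop by (metis coprime_dvd_mult_left_iff)
qed

text \<open>The binomial coefficient \<open>C(y, p^n - 1)\<close> is a \<open>p\<close>-adic unit if \<open>p^n\<close> divides \<open>y + 1\<close>, and
  divisible by \<open>p\<close> otherwise; a suitable power of it is therefore an indicator modulo \<open>p^K\<close>.\<close>

lemma binomial_power_indicator:
  fixes p :: nat
  assumes p: "prime p" and K: "K > 0"
  shows "[(y choose (p ^ n - 1)) ^ (K * totient (p ^ K)) = (if p ^ n dvd Suc y then 1 else 0)] (mod p ^ K)"
proof (cases "p ^ n dvd Suc y")
  case True
  then obtain m where m: "Suc y = p ^ n * m" by (auto elim: dvdE)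
  then have "m > 0" by (cases m) auto
  have "p ^ n > 0" using p by (simp add: prime_gt_0_nat)
  then have "\<not> p dvd ((p ^ n * m - 1) choose (p ^ n - 1))"
    using not_dvd_binomial_prime_power[OF p \<open>m > 0\<close>, of "p ^ n - 1" n] by simp
  then have "\<not> p dvd (y choose (p ^ n - 1))" using m by (metis diff_Suc_1)
  then have "coprime (y choose (p ^ n - 1)) (p ^ K)"
    using p prime_imp_coprime[of p "y choose (p ^ n - 1)"] by (simp add: coprime_commute)
  \<comment> \<open>The factor \<open>totient (p ^ K)\<close> of the exponent is meant for this
    case: Euler's theorem sends every unit to 1.\<close>
  from cong_pow[OF euler_theorem[OF this], of K] show ?thesis
    using True by (simp add: power_mult[symmetric] mult.commute)
next
  case False
  have "p ^ K > 0" using p by (simp add: prime_gt_0_nat)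
  then have "totient (p ^ K) > 0" by (simp only: totient_gt_0_iff)
  \<comment> \<open>The factor \<open>K\<close> of the exponent is meant for this case: a multiple
    of p raised to at least the K-th power vanishes modulo p^K.\<close>
  then have "K * 1 \<le> K * totient (p ^ K)" by (intro mult_le_mono2) linarith
  then have "K \<le> K * totient (p ^ K)" by simp
  moreover have "p dvd (y choose (p ^ n - 1))" by (rule dvd_binomial_prime_power[OF p False])
  ultimately have "p ^ K dvd (y choose (p ^ n - 1)) ^ (K * totient (p ^ K))"
    by (metis dvd_power_le)
  then show ?thesis using False by (simp add: cong_0_iff)
qed

text \<open>The shift \<open>c\<close> serves to move the indicator from the residue class of -1 to
  an arbitrary class.\<close>

lemma choose_poly:
  obtains f :: "rat poly" where "\<And>m::nat. poly f (of_nat m) = of_nat ((m + c) choose k)"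
proof -
  define f :: "rat poly" where "f = Polynomial.smult (inverse (fact k)) (\<Prod>i<k. [:of_nat c - of_nat i, 1:])"
  have "poly f (of_nat m) = of_nat ((m + c) choose k)" for m :: nat
    unfolding binomial_gbinomial
    by (simp add: f_def poly_prod gbinomial_prod_rev atLeast0LessThan algebra_simps divide_inverse)
  then show ?thesis by (rule that)
qed

lemma residue_indicator_poly:
  fixes p :: nat
  assumes p: "prime p" and K: "K > 0" and a: "a < p ^ n"
  obtains f :: "rat poly" and F :: "nat \<Rightarrow> nat" where "\<And>m. poly f (of_nat m) = of_nat (F m)"
    "\<And>m. [F m = (if m mod p ^ n = a then 1 else 0)] (mod p ^ K)"
proof -
  \<comment> \<open>Chosen so that m + c + 1 = m + (p^n - a), which p^n divides exactly when m is
    congruent to \<open>a\<close>; since a < p^n, the truncated subtraction is exact.\<close>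
  define c where "c = p ^ n - 1 - a"
  obtain g :: "rat poly" where g: "\<And>m::nat. poly g (of_nat m) = of_nat ((m + c) choose (p ^ n - 1))"
    by (rule choose_poly[of c "p ^ n - 1"]) blast
  have iff: "p ^ n dvd Suc (m + c) \<longleftrightarrow> m mod p ^ n = a" for m
  proof -
    have "p ^ n dvd Suc (m + c) \<longleftrightarrow> [m + (p ^ n - a) = a + (p ^ n - a)] (mod p ^ n)"
      using a by (simp add: c_def cong_def dvd_eq_mod_eq_0 Suc_diff_Suc)
    also have "\<dots> \<longleftrightarrow> [m = a] (mod p ^ n)" by (rule cong_add_rcancel_nat)
    also have "\<dots> \<longleftrightarrow> m mod p ^ n = a" using a by (simp add: cong_def)
    finally show ?thesis .
  qed
  show ?thesis
  proof (rule that[of "g ^ (K * totient (p ^ K))" "\<lambda>m. ((m + c) choose (p ^ n - 1)) ^ (K * totient (p ^ K))"])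
    fix m
    show "poly (g ^ (K * totient (p ^ K))) (of_nat m) =
        of_nat (((m + c) choose (p ^ n - 1)) ^ (K * totient (p ^ K)))"
      by (simp add: g)
    show "[((m + c) choose (p ^ n - 1)) ^ (K * totient (p ^ K)) =
        (if m mod p ^ n = a then 1 else 0)] (mod p ^ K)"
      using binomial_power_indicator[OF p K, of "m + c" n] by (simp only: iff)
  qed
qed

lemma residue_interpolation_poly:
  fixes p :: nat
  assumes p: "prime p" and K: "K > 0"
  obtains f :: "rat poly" and F :: "nat \<Rightarrow> nat" where "\<And>m. poly f (of_nat m) = of_nat (F m)"
    "\<And>m. [F m = g (m mod p ^ n)] (mod p ^ K)"
proof -
  have "\<exists>f F. (\<forall>m. poly f (of_nat m) = (of_nat (F m) :: rat)) \<and>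
      (\<forall>m. [F m = (if m mod p ^ n = a then 1 else 0)] (mod p ^ K))" if "a < p ^ n" for a
    by (rule residue_indicator_poly[OF p K that]) blast
  then obtain f F where fF: "\<And>a m. a < p ^ n \<Longrightarrow> poly (f a) (of_nat m) = (of_nat (F a m) :: rat)"
    "\<And>a m. a < p ^ n \<Longrightarrow> [F a m = (if m mod p ^ n = a then 1 else 0)] (mod p ^ K)"
    by metis
  \<comment> \<open>Interpolation over the finitely many residues: the indicators take the place of
    Lagrange basis polynomials.\<close>
  show ?thesis
  proof (rule that[of "\<Sum>a<p ^ n. Polynomial.smult (of_nat (g a)) (f a)" "\<lambda>m. \<Sum>a<p ^ n. g a * F a m"])
    fix m
    show "poly (\<Sum>a<p ^ n. Polynomial.smult (of_nat (g a)) (f a)) (of_nat m) = of_nat (\<Sum>a<p ^ n. g a * F a m)"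
      by (simp add: poly_sum fF)
    have "[(\<Sum>a<p ^ n. g a * F a m) = (\<Sum>a<p ^ n. g a * (if m mod p ^ n = a then 1 else 0))] (mod p ^ K)"
      by (intro cong_sum cong_mult fF) auto
    also have "(\<Sum>a<p ^ n. g a * (if m mod p ^ n = a then 1 else 0)) = g (m mod p ^ n)"
      using p by (simp add: if_distrib prime_gt_0_nat cong: if_cong)
    finally show "[(\<Sum>a<p ^ n. g a * F a m) = g (m mod p ^ n)] (mod p ^ K)" .
  qed
qed

lemma simultaneous_interpolation_poly:
  fixes P :: "nat set" and n :: "nat \<Rightarrow> nat" and g :: "nat \<Rightarrow> nat \<Rightarrow> nat"
  assumes P: "finite P" "P \<subseteq> primes" and K: "K > 0"
  obtains f :: "rat poly" and F :: "nat \<Rightarrow> nat" where "\<And>m. poly f (of_nat m) = of_nat (F m)"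
    "\<And>m p. p \<in> P \<Longrightarrow> [F m = g p (m mod p ^ n p)] (mod p ^ K)"
proof -
  have "\<exists>f F. (\<forall>m. poly f (of_nat m) = (of_nat (F m) :: rat)) \<and>
      (\<forall>m. [F m = g p (m mod p ^ n p)] (mod p ^ K))" if "prime p" for p
    by (rule residue_interpolation_poly[OF that K, of "g p" "n p"]) blast
  then obtain f F where fF: "\<And>p m. prime p \<Longrightarrow> poly (f p) (of_nat m) = (of_nat (F p m) :: rat)"
    "\<And>p m. prime p \<Longrightarrow> [F p m = g p (m mod p ^ n p)] (mod p ^ K)"
    by metis
  \<comment> \<open>Chinese remainder weights: for p in \<open>P\<close>, the weight of p is 1
    modulo p^K and 0 modulo q^K for the other primes q of \<open>P\<close>, so each summand is
    visible at its own prime only.\<close>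
  have "\<exists>c. \<forall>q\<in>P. [c = (if q = p then 1 else 0)] (mod q ^ K)" for p
    using P by (intro chinese_remainder_nat) (auto intro!: primes_coprime)
  then obtain c where c: "\<And>p q. q \<in> P \<Longrightarrow> [c p = (if q = p then 1 else 0)] (mod q ^ K)"
    by metis
  show ?thesis
  proof (rule that[of "\<Sum>p\<in>P. Polynomial.smult (of_nat (c p)) (f p)" "\<lambda>m. \<Sum>p\<in>P. c p * F p m"])
    fix m
    show "poly (\<Sum>p\<in>P. Polynomial.smult (of_nat (c p)) (f p)) (of_nat m) = of_nat (\<Sum>p\<in>P. c p * F p m)"
      using P by (auto simp: poly_sum fF intro!: sum.cong)
    fix q assume q: "q \<in> P"
    have "[(\<Sum>p\<in>P. c p * F p m) = (\<Sum>p\<in>P. (if q = p then 1 else 0) * F p m)] (mod q ^ K)"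
      by (intro cong_sum cong_mult c q) auto
    also have "(\<Sum>p\<in>P. (if q = p then 1 else 0) * F p m) = F q m"
      using P q by (simp add: if_distrib[of "\<lambda>x. x * _"] cong: if_cong)
    also have "[F q m = g q (m mod q ^ n q)] (mod q ^ K)" using P q by (intro fF) auto
    finally show "[(\<Sum>p\<in>P. c p * F p m) = g q (m mod q ^ n q)] (mod q ^ K)" .
  qed
qed

section \<open>Approximation of continuous functions\<close>

abbreviation Qp_of_nat :: "nat \<Rightarrow> nat \<Rightarrow> padic" where
  "Qp_of_nat p m \<equiv> padic_class p (\<lambda>n. of_nat m)"

lemma Qp_dist_of_nat:
  "prime p \<Longrightarrow> Qp_dist p (Qp_of_nat p a) (Qp_of_nat p b) = padic_abs p (of_nat a - of_nat b)"
  using Qp_dist_class[of p "\<lambda>n. of_nat a" "\<lambda>n. of_nat b"] by (auto intro: LIMSEQ_unique)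

lemma Qp_dist_of_nat_cong:
  assumes p: "prime p" and ab: "[a = b] (mod p ^ k)"
  shows "Qp_dist p (Qp_of_nat p a) (Qp_of_nat p b) \<le> inverse (real p ^ k)"
proof -
  have "[int a = int b] (mod int p ^ k)" using ab by (metis cong_int_iff of_nat_power)
  then have "int p ^ k dvd int a - int b" by (simp add: cong_iff_dvd_diff)
  then have "padic_abs p (of_int (int a - int b)) \<le> inverse (real p ^ k)"
    by (subst padic_abs_of_int_le_iff[OF p])
  then show ?thesis by (simp add: Qp_dist_of_nat[OF p])
qed

text \<open>The residue of \<open>x\<close> modulo p^n is expressed by natural numbers
  \<open>m\<close> within p^-n of \<open>x\<close>, which avoids constructing a reduction map on
  Z_p. In this form the result combines directly with polynomials known only through their values on
  naturals.\<close>

lemma Zp_continuous_locally_constant: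
  assumes p: "prime p" and S: "compactin (Zp_top p) S"
    and \<Phi>: "continuous_map (subtopology (Zp_top p) S) (Zp_top p) \<Phi>" and e: "e > 0"
  shows "\<exists>n g. \<forall>x\<in>S. \<forall>m::nat. Qp_dist p x (Qp_of_nat p m) \<le> inverse (real p ^ n) \<longrightarrow>
    Qp_dist p (\<Phi> x) (Qp_of_nat p (g (m mod p ^ n))) < e"
proof -
  interpret Metric_space "carrier (Zp_ring p)" "Qp_dist p" by (rule Metric_space_Zp[OF p])
  define M where "M = metric (carrier (Zp_ring p), Qp_dist p)"
  have M: "mtopology_of M = Zp_top p" "mspace M = carrier (Zp_ring p)" "mdist M = Qp_dist p"
    by (simp_all add: M_def Zp_top_def)
  have SZ: "S \<subseteq> carrier (Zp_ring p)"
    using compactin_subset_topspace[OF S] by (simp add: topspace_Zp[OF p])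
  have \<Phi>Z: "\<Phi> x \<in> carrier (Zp_ring p)" if "x \<in> S" for x
    using continuous_map_funspace[OF \<Phi>] that SZ by (auto simp: topspace_Zp[OF p])
  have "uniformly_continuous_map (submetric M S) M \<Phi>"
    using S \<Phi> by (intro continuous_imp_uniformly_continuous_map)
      (simp add: mtopology_of_submetric M compact_space_subtopology)
  then obtain \<delta> where \<delta>: "\<delta> > 0"
    "\<And>x y. x \<in> S \<Longrightarrow> y \<in> S \<Longrightarrow> Qp_dist p y x < \<delta> \<Longrightarrow> Qp_dist p (\<Phi> y) (\<Phi> x) < e"
    using e SZ unfolding uniformly_continuous_map_def by (simp add: M inf.absorb1) metis
  have "\<exists>n. inverse (real p ^ n) < \<delta>"
    using order_tendstoD(2)[OF inverse_prime_power_tendsto[OF p] \<delta>(1)]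
    by (auto simp: eventually_sequentially)
  then obtain n where n: "inverse (real p ^ n) < \<delta>" by blast
  \<comment> \<open>If the ball around \<open>a\<close> misses \<open>S\<close>, any
    \<open>b\<close> will do. Otherwise \<open>b\<close> approximates the value at one point of the
    ball, and all other points of \<open>S\<close> in the ball lie within \<delta> of that
    point.\<close>
  have "\<exists>b. \<forall>x\<in>S. Qp_dist p x (Qp_of_nat p a) \<le> inverse (real p ^ n) \<longrightarrow>
      Qp_dist p (\<Phi> x) (Qp_of_nat p b) < e" for a
  proof (cases "\<exists>x\<in>S. Qp_dist p x (Qp_of_nat p a) \<le> inverse (real p ^ n)")
    case True
    then obtain y where y: "y \<in> S" "Qp_dist p y (Qp_of_nat p a) \<le> inverse (real p ^ n)" by blast
    \<comment> \<open>Density gives a non-strict bound, so e/2 is requested in order to stay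
      strictly below \<open>e\<close>.\<close>
    obtain b where b: "Qp_dist p (\<Phi> y) (Qp_of_nat p b) \<le> e / 2"
      by (rule Zp_nat_dense[OF p \<Phi>Z[OF y(1)], of "e / 2"]) (use e in auto)
    have "Qp_dist p (\<Phi> x) (Qp_of_nat p b) < e"
      if x: "x \<in> S" "Qp_dist p x (Qp_of_nat p a) \<le> inverse (real p ^ n)" for x
    proof -
      have "Qp_dist p x y \<le> max (Qp_dist p x (Qp_of_nat p a)) (Qp_dist p (Qp_of_nat p a) y)"
        using x y SZ by (intro Qp_dist_ultrametric[OF p]) (auto intro: Zp_imp_Qp)
      also have "\<dots> < \<delta>" using x y n by (simp add: Qp_dist_commute[OF p, of "Qp_of_nat p a"])
      finally have "Qp_dist p (\<Phi> x) (\<Phi> y) < e" using \<delta> x y by blast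
      moreover have "Qp_dist p (\<Phi> x) (Qp_of_nat p b) \<le>
          max (Qp_dist p (\<Phi> x) (\<Phi> y)) (Qp_dist p (\<Phi> y) (Qp_of_nat p b))"
        using x y by (intro Qp_dist_ultrametric[OF p]) (auto intro: Zp_imp_Qp \<Phi>Z)
      ultimately show ?thesis using b e by linarith
    qed
    then show ?thesis by blast
  qed blast
  then obtain g where g: "\<And>a x. x \<in> S \<Longrightarrow> Qp_dist p x (Qp_of_nat p a) \<le> inverse (real p ^ n) \<Longrightarrow>
      Qp_dist p (\<Phi> x) (Qp_of_nat p (g a)) < e"
    by metis
  have "Qp_dist p (\<Phi> x) (Qp_of_nat p (g (m mod p ^ n))) < e"
    if x: "x \<in> S" "Qp_dist p x (Qp_of_nat p m) \<le> inverse (real p ^ n)" for x m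
  proof (rule g[OF x(1)])
    \<comment> \<open>Reducing \<open>m\<close> modulo p^n moves it by at most p^-n, hence it stays
      in the closed ball of that radius around \<open>x\<close>.\<close>
    have "Qp_dist p x (Qp_of_nat p (m mod p ^ n)) \<le>
        max (Qp_dist p x (Qp_of_nat p m)) (Qp_dist p (Qp_of_nat p m) (Qp_of_nat p (m mod p ^ n)))"
      using x SZ by (intro Qp_dist_ultrametric[OF p]) (auto intro: Zp_imp_Qp)
    also have "\<dots> \<le> inverse (real p ^ n)"
      using x Qp_dist_of_nat_cong[OF p, of m "m mod p ^ n" n] by (simp add: cong_def)
    finally show "Qp_dist p x (Qp_of_nat p (m mod p ^ n)) \<le> inverse (real p ^ n)" .
  qed
  then show ?thesis by blast
qed

text \<open>For a point x and a natural number m near it, the chain runs from \<Phi>(x) through g(m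
  mod p^n) and F(m) = f(m) to f(x). Every link is shorter than \<open>e\<close>, hence so is the
  total distance.\<close>

lemma simultaneous_padic_approximation:
  fixes S :: "nat \<Rightarrow> padic set" and \<Phi> :: "nat \<Rightarrow> padic \<Rightarrow> padic"
  assumes P: "finite P" "P \<subseteq> primes" and e: "e > 0"
    and S: "\<And>p. p \<in> P \<Longrightarrow> compactin (Zp_top p) (S p)"
    and \<Phi>: "\<And>p. p \<in> P \<Longrightarrow> continuous_map (subtopology (Zp_top p) (S p)) (Zp_top p) (\<Phi> p)"
  obtains f :: "rat poly" where "\<And>m::nat. poly f (of_nat m) \<in> \<int>"
    "\<And>p x. p \<in> P \<Longrightarrow> x \<in> S p \<Longrightarrow> Qp_dist p (\<Phi> p x) (Qp_eval p f x) < e"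
proof -
  have "\<exists>n g. \<forall>x\<in>S p. \<forall>m::nat. Qp_dist p x (Qp_of_nat p m) \<le> inverse (real p ^ n) \<longrightarrow>
    Qp_dist p (\<Phi> p x) (Qp_of_nat p (g (m mod p ^ n))) < e" if "p \<in> P" for p
    using that P by (intro Zp_continuous_locally_constant S \<Phi> e) auto
  then obtain n g where g: "\<And>p x m. p \<in> P \<Longrightarrow> x \<in> S p \<Longrightarrow>
      Qp_dist p x (Qp_of_nat p m) \<le> inverse (real p ^ n p) \<Longrightarrow>
      Qp_dist p (\<Phi> p x) (Qp_of_nat p (g p (m mod p ^ n p))) < e"
    by metis
  \<comment> \<open>Every prime is at least 2, so this \<open>K\<close> makes p^-K smaller than
    \<open>e\<close> for all p in \<open>P\<close> at once.\<close>
  obtain K where K: "K > 0" "inverse (2 ^ K) < e"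
    using real_arch_pow_inv[of e "1/2"] e
    by (metis field_sum_of_halves gr0I half_gt_zero_iff inverse_eq_divide less_add_same_cancel1
        less_trans power_0 power_one_over power_one_right zero_less_one power_strict_decreasing)
  obtain f F where f: "\<And>m. poly f (of_nat m) = (of_nat (F m) :: rat)"
    and F: "\<And>m p. p \<in> P \<Longrightarrow> [F m = g p (m mod p ^ n p)] (mod p ^ K)"
    by (rule simultaneous_interpolation_poly[OF P K(1), of g n]) blast
  have fZ: "poly f (of_nat m) \<in> \<int>" for m :: nat by (simp add: f)
  have "Qp_dist p (\<Phi> p x) (Qp_eval p f x) < e" if pP: "p \<in> P" and x: "x \<in> S p" for p x
  proof -
    have p: "prime p" using pP P by auto
    have xZ: "x \<in> carrier (Zp_ring p)"
      using compactin_subset_topspace[OF S[OF pP]] x by (auto simp: topspace_Zp[OF p])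
    have \<Phi>Z: "\<Phi> p x \<in> carrier (Zp_ring p)"
      using continuous_map_funspace[OF \<Phi>[OF pP]] x xZ by (auto simp: topspace_Zp[OF p])
    obtain C where C: "C > 0"
      "\<And>x y. x \<in> carrier (Zp_ring p) \<Longrightarrow> y \<in> carrier (Zp_ring p) \<Longrightarrow>
        Qp_dist p (Qp_eval p f x) (Qp_eval p f y) \<le> C * Qp_dist p x y"
      using Qp_eval_Lipschitz[OF p] by metis
    \<comment> \<open>The first bound places \<open>m\<close> in the residue class of
      \<open>x\<close>, where \<open>g\<close> applies; the second lets \<open>f\<close> vary by at
      most e/2. The choice of \<open>m\<close> comes after \<open>f\<close>, because
      \<open>C\<close> depends on \<open>f\<close>.\<close>
    have "min (inverse (real p ^ n p)) (e / (2 * C)) > 0"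
      using p C e by (simp add: prime_gt_0_nat)
    then obtain m where m: "Qp_dist p x (Qp_of_nat p m) \<le> min (inverse (real p ^ n p)) (e / (2 * C))"
      by (rule Zp_nat_dense[OF p xZ])
    have ev: "Qp_eval p f (Qp_of_nat p m) = Qp_of_nat p (F m)"
      by (simp add: Qp_eval_class[OF p] f)
    have "Qp_dist p (Qp_eval p f x) (Qp_of_nat p (F m)) \<le> C * Qp_dist p x (Qp_of_nat p m)"
      using C(2)[OF xZ padic_class_const_of_nat_Zp[OF p], of m] by (simp add: ev)
    also have "\<dots> \<le> C * (e / (2 * C))" using m C by (intro mult_left_mono) auto
    also have "\<dots> < e" using C e by simp
    finally have 1: "Qp_dist p (Qp_eval p f x) (Qp_of_nat p (F m)) < e" .
    have "Qp_dist p (Qp_of_nat p (F m)) (Qp_of_nat p (g p (m mod p ^ n p))) \<le> inverse (real p ^ K)"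
      by (intro Qp_dist_of_nat_cong p F pP)
    also have "\<dots> \<le> inverse (2 ^ K)"
      using prime_ge_2_nat[OF p] by (intro le_imp_inverse_le power_mono) auto
    finally have 2: "Qp_dist p (Qp_of_nat p (F m)) (Qp_of_nat p (g p (m mod p ^ n p))) < e"
      using K by simp
    have 3: "Qp_dist p (\<Phi> p x) (Qp_of_nat p (g p (m mod p ^ n p))) < e"
      using m by (intro g pP x) simp
    have fxZ: "Qp_eval p f x \<in> carrier (Qp p)" by (intro Zp_imp_Qp Qp_eval_Zp p fZ xZ)
    have "Qp_dist p (\<Phi> p x) (Qp_of_nat p (F m)) < e"
      using Qp_dist_ultrametric[OF p, of "\<Phi> p x" "Qp_of_nat p (g p (m mod p ^ n p))" "Qp_of_nat p (F m)"]
        2 3 \<Phi>Z Qp_dist_commute[OF p, of "Qp_of_nat p (F m)"]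
      by (auto simp: Zp_imp_Qp)
    then show ?thesis
      using Qp_dist_ultrametric[OF p, of "\<Phi> p x" "Qp_of_nat p (F m)" "Qp_eval p f x"]
        1 \<Phi>Z fxZ Qp_dist_commute[OF p, of "Qp_eval p f x"]
      by (auto simp: Zp_imp_Qp)
  qed
  then show ?thesis using that fZ by blast
qed

section \<open>Functions on compact sets of profinite integers\<close>

lemma ring_prod_ring:
  assumes R: "\<And>i. i \<in> I \<Longrightarrow> ring (R i)"
  shows "ring (prod_ring I R)"
proof -
  note ab = ring.is_abelian_group[OF R] and mon = ring.is_monoid[OF R]
  have eqI: "x = y" if "x \<in> extensional I" "y \<in> extensional I" "\<And>i. i \<in> I \<Longrightarrow> x i = y i"
    for x y :: "'a \<Rightarrow> 'b"
    using that by (rule extensionalityI)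
  show ?thesis
  proof (rule ringI)
    show "abelian_group (prod_ring I R)"
    proof (rule abelian_groupI)
      fix x assume x: "x \<in> carrier (prod_ring I R)"
      show "\<exists>y\<in>carrier (prod_ring I R). y \<oplus>\<^bsub>prod_ring I R\<^esub> x = \<zero>\<^bsub>prod_ring I R\<^esub>"
        using x ab by (intro bexI[of _ "\<lambda>i\<in>I. \<ominus>\<^bsub>R i\<^esub> x i"])
          (auto simp: prod_ring_def PiE_iff abelian_group.l_neg intro!: eqI abelian_group.a_inv_closed)
    qed (use ab in \<open>auto simp: prod_ring_def PiE_iff abelian_group.axioms(1)
        intro!: eqI abelian_monoid.a_closed abelian_monoid.zero_closed abelian_monoid.a_assoc
          abelian_monoid.a_comm abelian_monoid.l_zero\<close>)
    show "monoid (prod_ring I R)"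
      by (rule monoidI) (use mon in \<open>auto simp: prod_ring_def PiE_iff
        intro!: eqI monoid.m_closed monoid.m_assoc monoid.one_closed monoid.l_one monoid.r_one\<close>)
  qed (use R in \<open>auto simp: prod_ring_def PiE_iff intro!: eqI ring.ring_simprules(13) ring.ring_simprules(23)\<close>)
qed

lemma prod_ring_a_inv:
  assumes R: "\<And>i. i \<in> I \<Longrightarrow> ring (R i)" and x: "x \<in> carrier (prod_ring I R)"
  shows "\<ominus>\<^bsub>prod_ring I R\<^esub> x = (\<lambda>i\<in>I. \<ominus>\<^bsub>R i\<^esub> x i)"
proof -
  note ab = ring.is_abelian_group[OF R]
  interpret ring "prod_ring I R" by (rule ring_prod_ring[OF R])
  show ?thesis
    by (rule minus_equality)
      (use x ab in \<open>auto simp: prod_ring_def PiE_iff abelian_group.l_neg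
         intro!: abelian_group.a_inv_closed restrict_ext\<close>)
qed

text \<open>The additive inverse is a definite description over the carrier, so it must be checked
  that shrinking the carrier leaves it unchanged; uniqueness of inverses in the smaller ring does
  this.\<close>

lemma subring_a_inv:
  assumes "ring R" "subring H R" "h \<in> H"
  shows "\<ominus>\<^bsub>R\<lparr>carrier := H\<rparr>\<^esub> h = \<ominus>\<^bsub>R\<^esub> h"
proof -
  interpret R: ring R by fact
  interpret H: ring "R\<lparr>carrier := H\<rparr>" by (rule R.subring_is_ring) fact
  show ?thesis
    using subringE(1,5)[OF assms(2)] assms(3)
    by (intro H.minus_equality) (auto simp: R.l_neg)
qed

lemma Zp_ring_simps [simp]:
  "mult (Zp_ring p) = mult (Qp p)" "add (Zp_ring p) = add (Qp p)"
  "one (Zp_ring p) = one (Qp p)" "zero (Zp_ring p) = zero (Qp p)"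
  by (simp_all add: Zp_ring_def)

lemma Zp_a_inv: "prime p \<Longrightarrow> x \<in> carrier (Zp_ring p) \<Longrightarrow> \<ominus>\<^bsub>Zp_ring p\<^esub> x = \<ominus>\<^bsub>Qp p\<^esub> x"
  using subring_a_inv[OF cring.axioms(1)[OF cring_Qp] subring_Zp, of p x] by (simp add: Zp_ring_def)

lemma carrier_Zhat: "carrier Zhat_ring = (\<Pi>\<^sub>E p\<in>primes. carrier (Zp_ring p))"
  by (simp add: Zhat_ring_def prod_ring_def)

lemma ring_Zhat: "ring Zhat_ring"
  unfolding Zhat_ring_def by (rule ring_prod_ring) (simp add: ring_Zp)

lemma topspace_Zhat: "topspace Zhat_top = carrier Zhat_ring"
  unfolding Zhat_top_def carrier_Zhat topspace_product_topology
  by (intro PiE_cong) (simp add: topspace_Zp)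

text \<open>A common criterion for sum, product and negation: an operation that is nonexpansive for
  the maximum of the two distances preserves continuity with the same \<open>e\<close>.\<close>

lemma continuous_map_Zp_nonexpansive:
  assumes p: "prime p"
    and f: "continuous_map X (Zp_top p) f" and g: "continuous_map X (Zp_top p) g"
    and closed: "\<And>x y. x \<in> carrier (Zp_ring p) \<Longrightarrow> y \<in> carrier (Zp_ring p) \<Longrightarrow>
      h x y \<in> carrier (Zp_ring p)"
    and nonexp: "\<And>x y x' y'. x \<in> carrier (Zp_ring p) \<Longrightarrow> y \<in> carrier (Zp_ring p) \<Longrightarrow>
      x' \<in> carrier (Zp_ring p) \<Longrightarrow> y' \<in> carrier (Zp_ring p) \<Longrightarrow>
      Qp_dist p (h x y) (h x' y') \<le> max (Qp_dist p x x') (Qp_dist p y y')"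
  shows "continuous_map X (Zp_top p) (\<lambda>a. h (f a) (g a))"
proof -
  interpret Metric_space "carrier (Zp_ring p)" "Qp_dist p" by (rule Metric_space_Zp[OF p])
  show ?thesis
    unfolding Zp_top_def continuous_map_to_metric
  proof (intro ballI allI impI)
    fix a and e :: real assume a: "a \<in> topspace X" and e: "e > 0"
    obtain U where U: "openin X U" "a \<in> U" "\<And>b. b \<in> U \<Longrightarrow> f b \<in> mball (f a) e"
      using f a e unfolding Zp_top_def continuous_map_to_metric by meson
    obtain V where V: "openin X V" "a \<in> V" "\<And>b. b \<in> V \<Longrightarrow> g b \<in> mball (g a) e"
      using g a e unfolding Zp_top_def continuous_map_to_metric by meson
    have "h (f b) (g b) \<in> mball (h (f a) (g a)) e" if "b \<in> U \<inter> V" for b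
      using U(3)[of b] V(3)[of b] that nonexp[of "f a" "g a" "f b" "g b"] by (auto intro: closed)
    then show "\<exists>U. openin X U \<and> a \<in> U \<and> (\<forall>b\<in>U. h (f b) (g b) \<in> mball (h (f a) (g a)) e)"
      using U V by (intro exI[of _ "U \<inter> V"]) auto
  qed
qed

lemma continuous_map_Zp_add:
  assumes p: "prime p"
    and f: "continuous_map X (Zp_top p) f" and g: "continuous_map X (Zp_top p) g"
  shows "continuous_map X (Zp_top p) (\<lambda>a. f a \<oplus>\<^bsub>Qp p\<^esub> g a)"
proof (rule continuous_map_Zp_nonexpansive[OF p f g])
  interpret cring "Qp p" by (rule cring_Qp[OF p])
  fix x y x' y'
  assume "x \<in> carrier (Zp_ring p)" "y \<in> carrier (Zp_ring p)"
    "x' \<in> carrier (Zp_ring p)" "y' \<in> carrier (Zp_ring p)"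
  then have Q: "x \<in> carrier (Qp p)" "y \<in> carrier (Qp p)" "x' \<in> carrier (Qp p)" "y' \<in> carrier (Qp p)"
    by (auto intro: Zp_imp_Qp)
  then have "(x \<oplus>\<^bsub>Qp p\<^esub> y) \<ominus>\<^bsub>Qp p\<^esub> (x' \<oplus>\<^bsub>Qp p\<^esub> y') = (x \<ominus>\<^bsub>Qp p\<^esub> x') \<oplus>\<^bsub>Qp p\<^esub> (y \<ominus>\<^bsub>Qp p\<^esub> y')"
    by algebra
  then show "Qp_dist p (x \<oplus>\<^bsub>Qp p\<^esub> y) (x' \<oplus>\<^bsub>Qp p\<^esub> y') \<le> max (Qp_dist p x x') (Qp_dist p y y')"
    using Q Qp_abs_add[OF p, of "x \<ominus>\<^bsub>Qp p\<^esub> x'" "y \<ominus>\<^bsub>Qp p\<^esub> y'"] by (simp add: Qp_dist_def)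
qed (rule subringE(7)[OF subring_Zp[OF p]])

lemma continuous_map_Zp_mult:
  assumes p: "prime p"
    and f: "continuous_map X (Zp_top p) f" and g: "continuous_map X (Zp_top p) g"
  shows "continuous_map X (Zp_top p) (\<lambda>a. f a \<otimes>\<^bsub>Qp p\<^esub> g a)"
proof (rule continuous_map_Zp_nonexpansive[OF p f g])
  interpret cring "Qp p" by (rule cring_Qp[OF p])
  fix x y x' y'
  assume Z: "x \<in> carrier (Zp_ring p)" "y \<in> carrier (Zp_ring p)"
    "x' \<in> carrier (Zp_ring p)" "y' \<in> carrier (Zp_ring p)"
  then have Q: "x \<in> carrier (Qp p)" "y \<in> carrier (Qp p)" "x' \<in> carrier (Qp p)" "y' \<in> carrier (Qp p)"
    by (auto intro: Zp_imp_Qp)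
  \<comment> \<open>In this splitting the factors multiplying the two differences are p-adic
    integers, of absolute value at most 1, so the product does not expand distances.\<close>
  have "(x \<otimes>\<^bsub>Qp p\<^esub> y) \<ominus>\<^bsub>Qp p\<^esub> (x' \<otimes>\<^bsub>Qp p\<^esub> y') =
      ((x \<ominus>\<^bsub>Qp p\<^esub> x') \<otimes>\<^bsub>Qp p\<^esub> y) \<oplus>\<^bsub>Qp p\<^esub> (x' \<otimes>\<^bsub>Qp p\<^esub> (y \<ominus>\<^bsub>Qp p\<^esub> y'))"
    using Q by algebra
  then have "Qp_dist p (x \<otimes>\<^bsub>Qp p\<^esub> y) (x' \<otimes>\<^bsub>Qp p\<^esub> y') \<le>
      max (Qp_dist p x x' * Qp_abs p y) (Qp_abs p x' * Qp_dist p y y')"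
    using Q Qp_abs_add[OF p, of "(x \<ominus>\<^bsub>Qp p\<^esub> x') \<otimes>\<^bsub>Qp p\<^esub> y" "x' \<otimes>\<^bsub>Qp p\<^esub> (y \<ominus>\<^bsub>Qp p\<^esub> y')"]
    by (simp add: Qp_dist_def Qp_abs_mult[OF p])
  moreover have "Qp_dist p x x' * Qp_abs p y \<le> Qp_dist p x x'"
    using Z Q by (intro mult_right_le_one_le) (auto simp: Zp_ring_def Qp_dist_nonneg Qp_abs_nonneg p)
  moreover have "Qp_abs p x' * Qp_dist p y y' \<le> Qp_dist p y y'"
    using Z Q by (intro mult_left_le_one_le) (auto simp: Zp_ring_def Qp_dist_nonneg Qp_abs_nonneg p)
  ultimately show "Qp_dist p (x \<otimes>\<^bsub>Qp p\<^esub> y) (x' \<otimes>\<^bsub>Qp p\<^esub> y') \<le> max (Qp_dist p x x') (Qp_dist p y y')"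
    by linarith
qed (rule subringE(6)[OF subring_Zp[OF p]])

lemma continuous_map_Zp_uminus:
  assumes p: "prime p" and f: "continuous_map X (Zp_top p) f"
  shows "continuous_map X (Zp_top p) (\<lambda>a. \<ominus>\<^bsub>Qp p\<^esub> f a)"
proof (rule continuous_map_Zp_nonexpansive[OF p f f, where h = "\<lambda>x y. \<ominus>\<^bsub>Qp p\<^esub> x"])
  interpret cring "Qp p" by (rule cring_Qp[OF p])
  fix x y x' y'
  assume "x \<in> carrier (Zp_ring p)" "x' \<in> carrier (Zp_ring p)"
  then have Q: "x \<in> carrier (Qp p)" "x' \<in> carrier (Qp p)"
    by (auto intro: Zp_imp_Qp)
  then have "(\<ominus>\<^bsub>Qp p\<^esub> x) \<ominus>\<^bsub>Qp p\<^esub> (\<ominus>\<^bsub>Qp p\<^esub> x') = x' \<ominus>\<^bsub>Qp p\<^esub> x" by algebra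
  then have "Qp_dist p (\<ominus>\<^bsub>Qp p\<^esub> x) (\<ominus>\<^bsub>Qp p\<^esub> x') = Qp_dist p x' x"
    using Q by (simp add: Qp_dist_def)
  then show "Qp_dist p (\<ominus>\<^bsub>Qp p\<^esub> x) (\<ominus>\<^bsub>Qp p\<^esub> x') \<le> max (Qp_dist p x x') (Qp_dist p y y')"
    by (simp add: Qp_dist_commute[OF p, of x'])
qed (rule subringE(5)[OF subring_Zp[OF p]])

lemma continuous_map_Qp_eval:
  assumes p: "prime p" and f: "\<And>m::nat. poly f (of_nat m) \<in> \<int>"
  shows "continuous_map (Zp_top p) (Zp_top p) (Qp_eval p f)"
proof -
  interpret Metric_space "carrier (Zp_ring p)" "Qp_dist p" by (rule Metric_space_Zp[OF p])
  obtain C where C: "C > 0"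
    "\<And>x y. x \<in> carrier (Zp_ring p) \<Longrightarrow> y \<in> carrier (Zp_ring p) \<Longrightarrow>
      Qp_dist p (Qp_eval p f x) (Qp_eval p f y) \<le> C * Qp_dist p x y"
    using Qp_eval_Lipschitz[OF p] by metis
  show ?thesis
    unfolding Zp_top_def continuous_map_to_metric
  proof (intro ballI allI impI)
    fix x and e :: real assume "x \<in> topspace mtopology" and e: "e > 0"
    then have x: "x \<in> carrier (Zp_ring p)" by simp
    have "Qp_eval p f y \<in> mball (Qp_eval p f x) e" if y: "y \<in> mball x (e / C)" for y
    proof -
      have "Qp_dist p (Qp_eval p f x) (Qp_eval p f y) \<le> C * Qp_dist p x y" using C x y by auto
      also have "\<dots> < e" using y C by (simp add: field_simps)
      finally show ?thesis using Qp_eval_Zp[OF p f] x y by auto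
    qed
    then show "\<exists>U. openin mtopology U \<and> x \<in> U \<and> (\<forall>y\<in>U. Qp_eval p f y \<in> mball (Qp_eval p f x) e)"
      using C e x by (intro exI[of _ "mball x (e / C)"]) auto
  qed
qed

section \<open>The ring of continuous functions on E\<close>

lemma mem_carrier_C_Zhat:
  assumes "E \<subseteq> topspace Zhat_top"
  shows "\<phi> \<in> carrier (C_Zhat E) \<longleftrightarrow> \<phi> \<in> extensional E \<and> (\<forall>\<alpha>\<in>E. \<phi> \<alpha> \<in> extensional primes) \<and>
    (\<forall>p. prime p \<longrightarrow> continuous_map (subtopology Zhat_top E) (Zp_top p) (\<lambda>\<alpha>. \<phi> \<alpha> p))"
proof -
  have "topspace (subtopology Zhat_top E) = E" by (rule topspace_subtopology_subset[OF assms])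
  then show ?thesis
    by (auto simp: C_Zhat_def cont_funs_def Zhat_top_def continuous_map_componentwise)
qed

lemma C_Zhat_memI:
  assumes E: "E \<subseteq> topspace Zhat_top"
    and F: "\<And>p. prime p \<Longrightarrow> continuous_map (subtopology Zhat_top E) (Zp_top p) (F p)"
  shows "(\<lambda>\<alpha>\<in>E. \<lambda>p\<in>primes. F p \<alpha>) \<in> carrier (C_Zhat E)"
  unfolding mem_carrier_C_Zhat[OF E]
proof (intro conjI allI impI)
  have top: "topspace (subtopology Zhat_top E) = E" by (rule topspace_subtopology_subset[OF E])
  fix p :: nat assume p: "prime p"
  show "continuous_map (subtopology Zhat_top E) (Zp_top p)
      (\<lambda>\<alpha>. (\<lambda>\<alpha>\<in>E. \<lambda>p\<in>primes. F p \<alpha>) \<alpha> p)"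
    by (rule continuous_map_eq[OF F[OF p]]) (simp add: top p)
qed auto

lemma C_Zhat_apply_Zp:
  assumes "E \<subseteq> topspace Zhat_top" "\<phi> \<in> carrier (C_Zhat E)" "\<alpha> \<in> E" "prime p"
  shows "\<phi> \<alpha> p \<in> carrier (Zp_ring p)"
proof -
  have "continuous_map (subtopology Zhat_top E) (Zp_top p) (\<lambda>\<alpha>. \<phi> \<alpha> p)"
    using assms mem_carrier_C_Zhat by blast
  from continuous_map_funspace[OF this] show ?thesis
    using assms by (auto simp: topspace_Zp)
qed

lemma carrier_C_Zhat_subset:
  assumes "E \<subseteq> topspace Zhat_top"
  shows "carrier (C_Zhat E) \<subseteq> carrier (prod_ring E (\<lambda>_. Zhat_ring))"
proof
  fix \<phi> assume "\<phi> \<in> carrier (C_Zhat E)"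
  then have "\<phi> \<in> extensional E" "\<forall>\<alpha>\<in>E. \<phi> \<alpha> \<in> extensional primes"
    "\<forall>\<alpha>\<in>E. \<forall>p\<in>primes. \<phi> \<alpha> p \<in> carrier (Zp_ring p)"
    using assms C_Zhat_apply_Zp by (auto simp: mem_carrier_C_Zhat)
  then show "\<phi> \<in> carrier (prod_ring E (\<lambda>_. Zhat_ring))"
    by (auto simp: prod_ring_def carrier_Zhat PiE_iff)
qed

text \<open>Both levels of products are unfolded down to \<open>Qp p\<close>. Negation is not a
  field of the ring record but depends on the carrier, hence its membership hypothesis and its
  separate proof.\<close>

lemma prod_Zhat_ops:
  fixes E :: "(nat \<Rightarrow> padic) set"
  defines "B \<equiv> prod_ring E (\<lambda>_. Zhat_ring)"
  shows "\<phi> \<oplus>\<^bsub>B\<^esub> \<psi> = (\<lambda>\<alpha>\<in>E. \<lambda>p\<in>primes. \<phi> \<alpha> p \<oplus>\<^bsub>Qp p\<^esub> \<psi> \<alpha> p)"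
    and "\<phi> \<otimes>\<^bsub>B\<^esub> \<psi> = (\<lambda>\<alpha>\<in>E. \<lambda>p\<in>primes. \<phi> \<alpha> p \<otimes>\<^bsub>Qp p\<^esub> \<psi> \<alpha> p)"
    and "\<one>\<^bsub>B\<^esub> = (\<lambda>\<alpha>\<in>E. \<lambda>p\<in>primes. \<one>\<^bsub>Qp p\<^esub>)"
    and "\<phi> \<in> carrier B \<Longrightarrow> \<ominus>\<^bsub>B\<^esub> \<phi> = (\<lambda>\<alpha>\<in>E. \<lambda>p\<in>primes. \<ominus>\<^bsub>Qp p\<^esub> \<phi> \<alpha> p)"
proof -
  assume \<phi>: "\<phi> \<in> carrier B"
  have "\<ominus>\<^bsub>Zhat_ring\<^esub> \<phi> \<alpha> = (\<lambda>p\<in>primes. \<ominus>\<^bsub>Qp p\<^esub> \<phi> \<alpha> p)" if "\<alpha> \<in> E" for \<alpha>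
  proof -
    have \<alpha>: "\<phi> \<alpha> \<in> carrier Zhat_ring" using \<phi> that by (auto simp: B_def prod_ring_def)
    then have "\<ominus>\<^bsub>Zhat_ring\<^esub> \<phi> \<alpha> = (\<lambda>p\<in>primes. \<ominus>\<^bsub>Zp_ring p\<^esub> \<phi> \<alpha> p)"
      unfolding Zhat_ring_def by (intro prod_ring_a_inv) (auto simp: ring_Zp)
    also have "\<dots> = (\<lambda>p\<in>primes. \<ominus>\<^bsub>Qp p\<^esub> \<phi> \<alpha> p)"
      using \<alpha> by (intro restrict_ext Zp_a_inv) (auto simp: carrier_Zhat)
    finally show ?thesis .
  qed
  then show "\<ominus>\<^bsub>B\<^esub> \<phi> = (\<lambda>\<alpha>\<in>E. \<lambda>p\<in>primes. \<ominus>\<^bsub>Qp p\<^esub> \<phi> \<alpha> p)"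
    using \<phi> prod_ring_a_inv[of E "\<lambda>_. Zhat_ring" \<phi>] ring_Zhat unfolding B_def by auto
qed (simp_all add: B_def Zhat_ring_def prod_ring_def cong: restrict_cong)

lemma subring_C_Zhat:
  assumes E: "E \<subseteq> topspace Zhat_top"
  shows "subring (carrier (C_Zhat E)) (prod_ring E (\<lambda>_. Zhat_ring))"
proof -
  interpret ring "prod_ring E (\<lambda>_. Zhat_ring)" by (rule ring_prod_ring) (rule ring_Zhat)
  note mem = mem_carrier_C_Zhat[OF E]
  have cont: "continuous_map (subtopology Zhat_top E) (Zp_top p) (\<lambda>\<alpha>. \<phi> \<alpha> p)"
    if "\<phi> \<in> carrier (C_Zhat E)" "prime p" for \<phi> p
    using that by (simp add: mem)
  note sub = carrier_C_Zhat_subset[OF E]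
  show ?thesis
  proof (rule subringI)
    show "\<one>\<^bsub>prod_ring E (\<lambda>_. Zhat_ring)\<^esub> \<in> carrier (C_Zhat E)"
      unfolding prod_Zhat_ops
      by (rule C_Zhat_memI[OF E]) (simp add: topspace_Zp subringE(3)[OF subring_Zp])
  next
    fix \<phi> assume "\<phi> \<in> carrier (C_Zhat E)"
    moreover from this have "\<phi> \<in> carrier (prod_ring E (\<lambda>_. Zhat_ring))" using sub by blast
    ultimately show "\<ominus>\<^bsub>prod_ring E (\<lambda>_. Zhat_ring)\<^esub> \<phi> \<in> carrier (C_Zhat E)"
      by (simp only: prod_Zhat_ops(4)) (intro C_Zhat_memI[OF E] continuous_map_Zp_uminus cont)
  next
    fix \<phi> \<psi> assume "\<phi> \<in> carrier (C_Zhat E)" "\<psi> \<in> carrier (C_Zhat E)"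
    then show "\<phi> \<otimes>\<^bsub>prod_ring E (\<lambda>_. Zhat_ring)\<^esub> \<psi> \<in> carrier (C_Zhat E)"
      "\<phi> \<oplus>\<^bsub>prod_ring E (\<lambda>_. Zhat_ring)\<^esub> \<psi> \<in> carrier (C_Zhat E)"
      unfolding prod_Zhat_ops
      by - (intro C_Zhat_memI[OF E] continuous_map_Zp_mult continuous_map_Zp_add cont; assumption)+
  qed (rule sub)
qed

text \<open>Each projection \<open>E \<rightarrow> E\<^sub>p\<close> is a quotient map, because \<open>E\<close> is compact and \<open>E\<^sub>p\<close> Hausdorff;
  hence continuity on \<open>E\<^sub>p\<close> needs no separate verification.\<close>

lemma quotient_map_Zhat_proj:
  assumes E: "compactin Zhat_top E" and p: "prime p"
  shows "quotient_map (subtopology Zhat_top E) (subtopology (Zp_top p) (Zhat_proj p E)) (\<lambda>\<alpha>. \<alpha> p)"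
proof (rule continuous_imp_quotient_map)
  have top: "topspace (subtopology Zhat_top E) = E"
    by (rule topspace_subtopology_subset[OF compactin_subset_topspace[OF E]])
  have cont: "continuous_map (subtopology Zhat_top E) (Zp_top p) (\<lambda>\<alpha>. \<alpha> p)"
    unfolding Zhat_top_def using p
    by (intro continuous_map_from_subtopology continuous_map_product_projection) simp
  then show "continuous_map (subtopology Zhat_top E) (subtopology (Zp_top p) (Zhat_proj p E)) (\<lambda>\<alpha>. \<alpha> p)"
    by (auto simp: continuous_map_in_subtopology Zhat_proj_def top)
  show "compact_space (subtopology Zhat_top E)" by (rule compact_space_subtopology[OF E])
  show "Hausdorff_space (subtopology (Zp_top p) (Zhat_proj p E))"
    unfolding Zp_top_def
    by (intro Hausdorff_space_subtopology Metric_space.Hausdorff_space_mtopology Metric_space_Zp p)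
  have "Zhat_proj p E \<subseteq> topspace (Zp_top p)"
    using continuous_map_funspace[OF cont] unfolding top by (auto simp: Zhat_proj_def)
  then show "(\<lambda>\<alpha>. \<alpha> p) ` topspace (subtopology Zhat_top E) =
      topspace (subtopology (Zp_top p) (Zhat_proj p E))"
    unfolding top by (simp only: topspace_subtopology_subset) (simp add: Zhat_proj_def)
qed

lemma Zhat_proj_topspace:
  assumes E: "compactin Zhat_top E" and p: "prime p"
  shows "topspace (subtopology (Zp_top p) (Zhat_proj p E)) = Zhat_proj p E"
proof -
  have "topspace (subtopology Zhat_top E) = E"
    by (rule topspace_subtopology_subset[OF compactin_subset_topspace[OF E]])
  then show ?thesis
    using quotient_imp_surjective_map[OF quotient_map_Zhat_proj[OF E p]] by (simp add: Zhat_proj_def)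
qed

section \<open>Functions that factor through the projections\<close>

lemma prod_fun_restrict:
  assumes E: "E \<subseteq> topspace Zhat_top"
  shows "restrict (prod_fun E \<Phi>) E = (\<lambda>\<alpha>\<in>E. \<lambda>p\<in>primes. \<Phi> p (\<alpha> p))"
proof (rule restrict_ext)
  fix \<alpha> assume \<alpha>: "\<alpha> \<in> E"
  then have "\<alpha> \<in> extensional primes" using E by (auto simp: topspace_Zhat carrier_Zhat PiE_def)
  then have "\<alpha> \<in> (\<Pi>\<^sub>E p\<in>primes. Zhat_proj p E)" using \<alpha> by (auto simp: Zhat_proj_def PiE_def)
  then show "prod_fun E \<Phi> \<alpha> = (\<lambda>p\<in>primes. \<Phi> p (\<alpha> p))" by (simp add: prod_fun_def)
qed

text \<open>The existence of the component functions is traded for a pointwise condition on the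
  fibres of the projections. That condition is easily seen to be stable under ring operations and
  under uniform limits.\<close>

lemma prod_C_restrictions_iff:
  assumes E: "compactin Zhat_top E"
  shows "\<phi> \<in> prod_C_restrictions E \<longleftrightarrow> \<phi> \<in> carrier (C_Zhat E) \<and>
    (\<forall>p. prime p \<longrightarrow> (\<forall>\<alpha>\<in>E. \<forall>\<beta>\<in>E. \<alpha> p = \<beta> p \<longrightarrow> \<phi> \<alpha> p = \<phi> \<beta> p))"
proof -
  note ET = compactin_subset_topspace[OF E]
  note mem = mem_carrier_C_Zhat[OF ET]
  have top: "topspace (subtopology Zhat_top E) = E" by (rule topspace_subtopology_subset[OF ET])
  note quot = quotient_map_Zhat_proj[OF E]
  show ?thesis
  proof (intro iffI conjI)
    assume "\<phi> \<in> prod_C_restrictions E"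
    then obtain \<Phi> where \<Phi>: "\<Phi> \<in> prod_C E" and \<phi>: "\<phi> = (\<lambda>\<alpha>\<in>E. \<lambda>p\<in>primes. \<Phi> p (\<alpha> p))"
      by (auto simp: prod_C_restrictions_def prod_fun_restrict[OF ET])
    have "continuous_map (subtopology Zhat_top E) (Zp_top p) (\<Phi> p \<circ> (\<lambda>\<alpha>. \<alpha> p))" if "prime p" for p
      using \<Phi> that by (subst continuous_compose_quotient_map_eq[OF quot[OF that]])
        (auto simp: prod_C_def cont_funs_def)
    then show "\<phi> \<in> carrier (C_Zhat E)"
      unfolding \<phi> by (intro C_Zhat_memI[OF ET]) (simp add: o_def)
    show "\<forall>p. prime p \<longrightarrow> (\<forall>\<alpha>\<in>E. \<forall>\<beta>\<in>E. \<alpha> p = \<beta> p \<longrightarrow> \<phi> \<alpha> p = \<phi> \<beta> p)"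
      unfolding \<phi> by auto
  next
    assume "\<phi> \<in> carrier (C_Zhat E) \<and>
      (\<forall>p. prime p \<longrightarrow> (\<forall>\<alpha>\<in>E. \<forall>\<beta>\<in>E. \<alpha> p = \<beta> p \<longrightarrow> \<phi> \<alpha> p = \<phi> \<beta> p))"
    then have \<phi>: "\<phi> \<in> carrier (C_Zhat E)"
      and fib: "\<And>p \<alpha> \<beta>. prime p \<Longrightarrow> \<alpha> \<in> E \<Longrightarrow> \<beta> \<in> E \<Longrightarrow> \<alpha> p = \<beta> p \<Longrightarrow> \<phi> \<alpha> p = \<phi> \<beta> p"
      by blast+
    \<comment> \<open>\<open>SOME\<close> picks an arbitrary point of the fibre over x; by
      \<open>fib\<close> the value does not depend on it.\<close>
    define \<Phi> where "\<Phi> = (\<lambda>p\<in>primes. \<lambda>x\<in>Zhat_proj p E. \<phi> (SOME \<alpha>. \<alpha> \<in> E \<and> \<alpha> p = x) p)"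
    have \<Phi>: "\<Phi> p (\<alpha> p) = \<phi> \<alpha> p" if "prime p" "\<alpha> \<in> E" for p \<alpha>
    proof -
      have "\<alpha> p \<in> Zhat_proj p E" using that by (simp add: Zhat_proj_def)
      moreover have "(SOME \<beta>. \<beta> \<in> E \<and> \<beta> p = \<alpha> p) \<in> E \<and> (SOME \<beta>. \<beta> \<in> E \<and> \<beta> p = \<alpha> p) p = \<alpha> p"
        by (rule someI[of _ \<alpha>]) (simp add: that)
      ultimately show ?thesis
        using that fib[of p "SOME \<beta>. \<beta> \<in> E \<and> \<beta> p = \<alpha> p" \<alpha>] by (simp add: \<Phi>_def)
    qed
    have "continuous_map (subtopology (Zp_top p) (Zhat_proj p E)) (Zp_top p) (\<Phi> p)" if p: "prime p" for p
    proof -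
      have "continuous_map (subtopology Zhat_top E) (Zp_top p) (\<lambda>\<alpha>. \<phi> \<alpha> p)"
        using \<phi> p by (simp add: mem)
      then have "continuous_map (subtopology Zhat_top E) (Zp_top p) (\<Phi> p \<circ> (\<lambda>\<alpha>. \<alpha> p))"
        by (rule continuous_map_eq) (simp add: \<Phi> p top)
      then show ?thesis by (simp add: continuous_compose_quotient_map_eq[OF quot[OF p]])
    qed
    then have "\<Phi> \<in> prod_C E"
      unfolding prod_C_def cont_funs_def
      by (auto simp: Zhat_proj_topspace[OF E] \<Phi>_def simp del: topspace_subtopology)
    moreover have "\<phi> = restrict (prod_fun E \<Phi>) E"
      unfolding prod_fun_restrict[OF ET]
    proof (rule extensionalityI)
      show "\<phi> \<in> extensional E" using \<phi> by (simp add: mem)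
      fix \<alpha> assume \<alpha>: "\<alpha> \<in> E"
      show "\<phi> \<alpha> = (\<lambda>\<alpha>\<in>E. \<lambda>p\<in>primes. \<Phi> p (\<alpha> p)) \<alpha>"
        by (rule extensionalityI[of _ primes]) (use \<phi> \<alpha> in \<open>auto simp: mem \<Phi>\<close>)
    qed auto
    ultimately show "\<phi> \<in> prod_C_restrictions E" by (simp add: prod_C_restrictions_def)
  qed
qed

lemma prod_C_restrictionsI:
  assumes "compactin Zhat_top E" "\<phi> \<in> carrier (C_Zhat E)"
    and "\<And>p \<alpha> \<beta>. prime p \<Longrightarrow> \<alpha> \<in> E \<Longrightarrow> \<beta> \<in> E \<Longrightarrow> \<alpha> p = \<beta> p \<Longrightarrow> \<phi> \<alpha> p = \<phi> \<beta> p"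
  shows "\<phi> \<in> prod_C_restrictions E"
  using assms(2,3) unfolding prod_C_restrictions_iff[OF assms(1)] by blast

lemma prod_C_restrictionsD:
  assumes "compactin Zhat_top E" "\<phi> \<in> prod_C_restrictions E"
    and "prime p" "\<alpha> \<in> E" "\<beta> \<in> E" "\<alpha> p = \<beta> p"
  shows "\<phi> \<alpha> p = \<phi> \<beta> p"
  using assms(2-) unfolding prod_C_restrictions_iff[OF assms(1)] by blast

lemma prod_C_restrictions_subset:
  assumes "compactin Zhat_top E"
  shows "prod_C_restrictions E \<subseteq> carrier (C_Zhat E)"
  using prod_C_restrictions_iff[OF assms] by blast

lemma subring_prod_C_restrictions:
  assumes E: "compactin Zhat_top E"
  shows "subring (prod_C_restrictions E) (C_Zhat E)"
proof -
  define B where "B = prod_ring E (\<lambda>_. Zhat_ring)"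
  note ET = compactin_subset_topspace[OF E]
  interpret ring B unfolding B_def by (rule ring_prod_ring) (rule ring_Zhat)
  note I = prod_C_restrictionsI[OF E] and D = prod_C_restrictionsD[OF E]
  note C = subring_C_Zhat[OF ET, folded B_def]
  note ops = prod_Zhat_ops[where E = E, folded B_def]
  have subB: "carrier (C_Zhat E) \<subseteq> carrier B" by (rule subringE(1)[OF C])
  note sub = prod_C_restrictions_subset[OF E]
  \<comment> \<open>The closure properties are checked in the full product ring \<open>B\<close>,
    where the operations are explicit, including negation; they are transferred afterwards, since
    \<open>C_Zhat E\<close> is \<open>B\<close> with a smaller carrier.\<close>
  have "subring (prod_C_restrictions E) B"
  proof (rule subringI)
    show "\<one>\<^bsub>B\<^esub> \<in> prod_C_restrictions E"
      by (rule I[OF subringE(3)[OF C]]) (simp add: ops)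
  next
    fix \<phi> assume \<phi>: "\<phi> \<in> prod_C_restrictions E"
    have eq: "\<ominus>\<^bsub>B\<^esub> \<phi> = (\<lambda>\<alpha>\<in>E. \<lambda>p\<in>primes. \<ominus>\<^bsub>Qp p\<^esub> \<phi> \<alpha> p)"
      using \<phi> sub subB by (intro ops) auto
    show "\<ominus>\<^bsub>B\<^esub> \<phi> \<in> prod_C_restrictions E"
    proof (rule I)
      show "\<ominus>\<^bsub>B\<^esub> \<phi> \<in> carrier (C_Zhat E)" using \<phi> sub by (intro subringE(5)[OF C]) auto
    next
      fix p \<alpha> \<beta> assume *: "prime p" "\<alpha> \<in> E" "\<beta> \<in> E" "\<alpha> p = \<beta> p"
      show "(\<ominus>\<^bsub>B\<^esub> \<phi>) \<alpha> p = (\<ominus>\<^bsub>B\<^esub> \<phi>) \<beta> p"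
        using *(1-3) D[OF \<phi> *] by (simp add: eq)
    qed
  next
    fix \<phi> \<psi> assume \<phi>: "\<phi> \<in> prod_C_restrictions E" and \<psi>: "\<psi> \<in> prod_C_restrictions E"
    show "\<phi> \<otimes>\<^bsub>B\<^esub> \<psi> \<in> prod_C_restrictions E"
    proof (rule I)
      show "\<phi> \<otimes>\<^bsub>B\<^esub> \<psi> \<in> carrier (C_Zhat E)" using \<phi> \<psi> sub by (intro subringE(6)[OF C]) auto
    next
      fix p \<alpha> \<beta> assume *: "prime p" "\<alpha> \<in> E" "\<beta> \<in> E" "\<alpha> p = \<beta> p"
      show "(\<phi> \<otimes>\<^bsub>B\<^esub> \<psi>) \<alpha> p = (\<phi> \<otimes>\<^bsub>B\<^esub> \<psi>) \<beta> p"
        using *(1-3) D[OF \<phi> *] D[OF \<psi> *] by (simp add: ops)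
    qed
    show "\<phi> \<oplus>\<^bsub>B\<^esub> \<psi> \<in> prod_C_restrictions E"
    proof (rule I)
      show "\<phi> \<oplus>\<^bsub>B\<^esub> \<psi> \<in> carrier (C_Zhat E)" using \<phi> \<psi> sub by (intro subringE(7)[OF C]) auto
    next
      fix p \<alpha> \<beta> assume *: "prime p" "\<alpha> \<in> E" "\<beta> \<in> E" "\<alpha> p = \<beta> p"
      show "(\<phi> \<oplus>\<^bsub>B\<^esub> \<psi>) \<alpha> p = (\<phi> \<oplus>\<^bsub>B\<^esub> \<psi>) \<beta> p"
        using *(1-3) D[OF \<phi> *] D[OF \<psi> *] by (simp add: ops)
    qed
  qed (use sub subB in auto)
  then have "ring ((B\<lparr>carrier := carrier (C_Zhat E)\<rparr>)\<lparr>carrier := prod_C_restrictions E\<rparr>)"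
    using subring_is_ring by simp
  moreover have "B\<lparr>carrier := carrier (C_Zhat E)\<rparr> = C_Zhat E"
    by (simp add: C_Zhat_def B_def)
  moreover have "ring (B\<lparr>carrier := carrier (C_Zhat E)\<rparr>)" by (rule subring_is_ring[OF C])
  ultimately show ?thesis using sub by (simp add: ring.subring_iff)
qed

section \<open>The topology of uniform convergence\<close>

lemma openin_unif_top: "openin (unif_top E) = unif_open E"
  unfolding unif_top_def by (rule topology_inverse'[OF istopology_unif_open])

lemma topspace_unif_top: "topspace (unif_top E) = carrier (C_Zhat E)"
proof
  show "topspace (unif_top E) \<subseteq> carrier (C_Zhat E)"
    by (auto simp: topspace_def openin_unif_top unif_open_def)
  \<comment> \<open>With the empty set of primes the neighbourhood is the whole carrier.\<close>
  have "unif_open E (carrier (C_Zhat E))"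
    unfolding unif_open_def
    by (intro conjI ballI exI[of _ "{}"] exI[of _ 1]) (auto simp: unif_nbhd_def)
  then show "carrier (C_Zhat E) \<subseteq> topspace (unif_top E)"
    by (intro openin_subset) (simp add: openin_unif_top)
qed

text \<open>As with balls in an ultrametric space, every point of a basic neighbourhood is a centre:
  the same \<open>P\<close> and \<open>e\<close> work around each of its members.\<close>

lemma unif_open_unif_nbhd:
  assumes E: "E \<subseteq> topspace Zhat_top" and P: "finite P" "P \<subseteq> primes" and e: "e > 0"
    and \<phi>: "\<phi> \<in> carrier (C_Zhat E)"
  shows "unif_open E (unif_nbhd E P e \<phi>)"
  unfolding unif_open_def
proof (intro conjI ballI)
  fix \<psi> assume \<psi>: "\<psi> \<in> unif_nbhd E P e \<phi>"
  have "unif_nbhd E P e \<psi> \<subseteq> unif_nbhd E P e \<phi>"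
  proof
    fix \<omega> assume \<omega>: "\<omega> \<in> unif_nbhd E P e \<psi>"
    have "Qp_dist p (\<phi> \<alpha> p) (\<omega> \<alpha> p) < e" if \<alpha>: "\<alpha> \<in> E" and pP: "p \<in> P" for \<alpha> p
    proof -
      have p: "prime p" using P pP by auto
      have "\<psi> \<in> carrier (C_Zhat E)" "\<omega> \<in> carrier (C_Zhat E)"
        using \<psi> \<omega> by (simp_all add: unif_nbhd_def)
      then have "\<phi> \<alpha> p \<in> carrier (Qp p)" "\<psi> \<alpha> p \<in> carrier (Qp p)" "\<omega> \<alpha> p \<in> carrier (Qp p)"
        using C_Zhat_apply_Zp[OF E _ \<alpha> p] \<phi> Zp_imp_Qp by blast+
      from Qp_dist_ultrametric[OF p this] show ?thesis
        using \<psi> \<omega> \<alpha> pP by (fastforce simp: unif_nbhd_def)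
    qed
    then show "\<omega> \<in> unif_nbhd E P e \<phi>" using \<omega> by (auto simp: unif_nbhd_def)
  qed
  then show "\<exists>P' e'. finite P' \<and> P' \<subseteq> primes \<and> e' > 0 \<and> unif_nbhd E P' e' \<psi> \<subseteq> unif_nbhd E P e \<phi>"
    using P e by blast
qed (auto simp: unif_nbhd_def)

text \<open>Basic neighbourhoods are open and contain their centre, so the closure can be tested on
  them alone.\<close>

lemma closure_of_unif_top:
  assumes E: "E \<subseteq> topspace Zhat_top"
  shows "\<phi> \<in> unif_top E closure_of S \<longleftrightarrow> \<phi> \<in> carrier (C_Zhat E) \<and>
    (\<forall>P e. finite P \<longrightarrow> P \<subseteq> primes \<longrightarrow> e > 0 \<longrightarrow> S \<inter> unif_nbhd E P e \<phi> \<noteq> {})"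
proof (intro iffI conjI allI impI)
  assume cl: "\<phi> \<in> unif_top E closure_of S"
  then show \<phi>: "\<phi> \<in> carrier (C_Zhat E)" by (simp add: in_closure_of topspace_unif_top)
  fix P and e :: real assume P: "finite P" "P \<subseteq> primes" and e: "e > 0"
  have "Qp_dist p (\<phi> \<alpha> p) (\<phi> \<alpha> p) = 0" if "\<alpha> \<in> E" "p \<in> P" for \<alpha> p
  proof -
    have "prime p" using that P by auto
    then show ?thesis
      using C_Zhat_apply_Zp[OF E \<phi> that(1)] by (simp add: Qp_dist_eq_0_iff Zp_imp_Qp)
  qed
  then have "\<phi> \<in> unif_nbhd E P e \<phi>" using \<phi> e by (simp add: unif_nbhd_def)
  then show "S \<inter> unif_nbhd E P e \<phi> \<noteq> {}"
    using cl unif_open_unif_nbhd[OF E P e \<phi>] by (auto simp: in_closure_of openin_unif_top)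
next
  assume R: "\<phi> \<in> carrier (C_Zhat E) \<and>
    (\<forall>P e. finite P \<longrightarrow> P \<subseteq> primes \<longrightarrow> e > 0 \<longrightarrow> S \<inter> unif_nbhd E P e \<phi> \<noteq> {})"
  show "\<phi> \<in> unif_top E closure_of S"
    unfolding in_closure_of topspace_unif_top openin_unif_top
  proof (intro conjI allI impI)
    fix T assume "\<phi> \<in> T \<and> unif_open E T"
    then obtain P e where "finite P" "P \<subseteq> primes" "e > 0" "unif_nbhd E P e \<phi> \<subseteq> T"
      unfolding unif_open_def by meson
    then show "\<exists>y. y \<in> S \<and> y \<in> T" using R by blast
  qed (use R in blast)
qed

text \<open>Continuity is included because a basic neighbourhood admits only members of the carrier
  of \<open>C_Zhat E\<close>.\<close>

lemma integer_valued_in_IntQ_functions: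
  assumes E: "E \<subseteq> topspace Zhat_top" and f: "\<And>m::nat. poly f (of_nat m) \<in> \<int>"
  shows "restrict (adelic_eval f) E \<in> IntQ_functions E"
    and "restrict (adelic_eval f) E \<in> carrier (C_Zhat E)"
proof -
  have "adelic_eval f \<alpha> \<in> carrier Zhat_ring" if "\<alpha> \<in> E" for \<alpha>
    using that E by (auto simp: adelic_eval_def topspace_Zhat carrier_Zhat intro!: Qp_eval_Zp f)
  then have "f \<in> IntQ E" by (auto simp: IntQ_def)
  then show "restrict (adelic_eval f) E \<in> IntQ_functions E" by (auto simp: IntQ_functions_def)
  have "continuous_map (subtopology Zhat_top E) (Zp_top p) (Qp_eval p f \<circ> (\<lambda>\<alpha>. \<alpha> p))"
    if p: "prime p" for p
    unfolding Zhat_top_def using p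
    by (intro continuous_map_compose[OF _ continuous_map_Qp_eval[OF p f]]
        continuous_map_from_subtopology continuous_map_product_projection) simp
  then show "restrict (adelic_eval f) E \<in> carrier (C_Zhat E)"
    unfolding adelic_eval_def[abs_def] by (intro C_Zhat_memI[OF E]) (simp add: o_def)
qed

section \<open>The two inclusions for the closure\<close>

lemma closure_IntQ_functions_subset:
  assumes "compactin Zhat_top E"
  shows "unif_top E closure_of IntQ_functions E \<subseteq> prod_C_restrictions E"
proof
  note ET = compactin_subset_topspace[OF assms]
  fix \<phi>
  assume "\<phi> \<in> unif_top E closure_of IntQ_functions E"
  then have \<phi>: "\<phi> \<in> carrier (C_Zhat E)" and
    app: "\<And>P e. finite P \<Longrightarrow> P \<subseteq> primes \<Longrightarrow> e > 0 \<Longrightarrow> IntQ_functions E \<inter> unif_nbhd E P e \<phi> \<noteq> {}"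
    unfolding closure_of_unif_top[OF ET] by blast+
  have "\<phi> \<alpha> p = \<phi> \<beta> p" if p: "prime p" and \<alpha>\<beta>: "\<alpha> \<in> E" "\<beta> \<in> E" "\<alpha> p = \<beta> p" for p \<alpha> \<beta>
  proof -
    have Z: "\<phi> \<alpha> p \<in> carrier (Qp p)" "\<phi> \<beta> p \<in> carrier (Qp p)"
      using C_Zhat_apply_Zp[OF ET \<phi> _ p] \<alpha>\<beta> by (auto intro: Zp_imp_Qp)
    have "Qp_dist p (\<phi> \<alpha> p) (\<phi> \<beta> p) < e" if e: "e > 0" for e
    proof -
      \<comment> \<open>The fibre condition concerns one prime at a time, so constraining the single
        component \<open>p\<close> is enough.\<close>
      obtain \<psi> where \<psi>: "\<psi> \<in> IntQ_functions E" "\<psi> \<in> unif_nbhd E {p} e \<phi>"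
        using app[of "{p}" e] p e by auto
      then obtain f where "\<psi> = restrict (adelic_eval f) E" by (auto simp: IntQ_functions_def)
      then have eq: "\<psi> \<alpha> p = \<psi> \<beta> p" using \<alpha>\<beta> p by (simp add: adelic_eval_def)
      have \<psi>C: "\<psi> \<in> carrier (C_Zhat E)"
        and \<psi>e: "Qp_dist p (\<phi> \<alpha> p) (\<psi> \<alpha> p) < e" "Qp_dist p (\<phi> \<beta> p) (\<psi> \<beta> p) < e"
        using \<psi>(2) \<alpha>\<beta> by (auto simp: unif_nbhd_def)
      from \<psi>C have "\<psi> \<alpha> p \<in> carrier (Qp p)"
        by (intro Zp_imp_Qp C_Zhat_apply_Zp[OF ET _ \<alpha>\<beta>(1) p])
      from Qp_dist_ultrametric[OF p Z(1) this Z(2)] show ?thesis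
        using \<psi>e eq Qp_dist_commute[OF p, of "\<psi> \<beta> p"] by simp
    qed
    then have "Qp_dist p (\<phi> \<alpha> p) (\<phi> \<beta> p) \<le> 0" by (meson less_irrefl not_le)
    then have "Qp_dist p (\<phi> \<alpha> p) (\<phi> \<beta> p) = 0" using Qp_dist_nonneg[OF p] by (simp add: antisym)
    then show ?thesis using Qp_dist_eq_0_iff[OF p Z] by simp
  qed
  then show "\<phi> \<in> prod_C_restrictions E" by (rule prod_C_restrictionsI[OF assms \<phi>])
qed

lemma prod_C_restrictions_subset_closure:
  assumes "compactin Zhat_top E"
  shows "prod_C_restrictions E \<subseteq> unif_top E closure_of IntQ_functions E"
proof
  note ET = compactin_subset_topspace[OF assms]
  fix \<phi>
  assume \<phi>: "\<phi> \<in> prod_C_restrictions E"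
  then obtain \<Phi> where \<Phi>: "\<Phi> \<in> prod_C E" and \<phi>\<Phi>: "\<phi> = (\<lambda>\<alpha>\<in>E. \<lambda>p\<in>primes. \<Phi> p (\<alpha> p))"
    by (auto simp: prod_C_restrictions_def prod_fun_restrict[OF ET])
  show "\<phi> \<in> unif_top E closure_of IntQ_functions E"
    unfolding closure_of_unif_top[OF ET]
  proof (intro conjI allI impI)
    show "\<phi> \<in> carrier (C_Zhat E)" using \<phi> prod_C_restrictions_subset[OF assms] by blast
    fix P and e :: real assume P: "finite P" "P \<subseteq> primes" and e: "e > 0"
    have cp: "compactin (Zp_top p) (Zhat_proj p E)" if "p \<in> P" for p
      unfolding Zhat_proj_def using that P
      by (intro image_compactin[OF assms]) (auto simp: Zhat_top_def)
    have ct: "continuous_map (subtopology (Zp_top p) (Zhat_proj p E)) (Zp_top p) (\<Phi> p)"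
      if "p \<in> P" for p
      using \<Phi> that P by (auto simp: prod_C_def cont_funs_def)
    obtain f where f: "\<And>m::nat. poly f (of_nat m) \<in> \<int>"
      and fe: "\<And>p x. p \<in> P \<Longrightarrow> x \<in> Zhat_proj p E \<Longrightarrow> Qp_dist p (\<Phi> p x) (Qp_eval p f x) < e"
      by (rule simultaneous_padic_approximation[OF P e cp ct]) blast+
    \<comment> \<open>Closeness is tested only at the primes of \<open>P\<close>; at all the others
      the values merely have to be p-adic integers, which the integer values of \<open>f\<close> on
      the naturals guarantee.\<close>
    have "restrict (adelic_eval f) E \<in> unif_nbhd E P e \<phi>"
      using integer_valued_in_IntQ_functions(2)[OF ET f] P
      by (auto simp: unif_nbhd_def \<phi>\<Phi> adelic_eval_def Zhat_proj_def subset_iff intro!: fe)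
    then show "IntQ_functions E \<inter> unif_nbhd E P e \<phi> \<noteq> {}"
      using integer_valued_in_IntQ_functions(1)[OF ET f] by blast
  qed
qed

theorem theorem1p5:
  fixes E :: "(nat \<Rightarrow> padic) set"
  assumes "compactin Zhat_top E"
  shows "subring (prod_C_restrictions E) (C_Zhat E) \<and>
    unif_top E closure_of IntQ_functions E = prod_C_restrictions E"
  using subring_prod_C_restrictions[OF assms] closure_IntQ_functions_subset[OF assms]
    prod_C_restrictions_subset_closure[OF assms] by blast

end
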